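(* The group $\widehat{2V}$ is presented, as a group, by the generators $v_i,h_i,\sigma_i$ ($i\in\mathbb N$) and the following relations, in which $x,y$ range over $\{h,v\}$ (each independently) and all subscripts are in $\mathbb N$: (R1) $x_jy_i=y_ix_{j+1}$ for $i<j$; (R2) $\sigma_i^2=1$ for $i\ge 0$; (R3) $\sigma_i\sigma_j=\sigma_j\sigma_i$ for $|i-j|\ge 2$; (R4) $\sigma_i\sigma_{i+1}\sigma_i=\sigma_{i+1}\sigma_i\sigma_{i+1}$ for $i\ge 0$; (R5) for $i\ge0$, $j\ge 0$: $\sigma_jx_i=x_i\sigma_{j+1}$ if $i<j$; $\sigma_jx_i=x_{j+1}\sigma_j\sigma_{j+1}$ if $i=j$; $\sigma_jx_i=x_j\sigma_{j+1}\sigma_j$ if $i=j+1$; $\sigma_jx_i=x_i\sigma_j$ if $i>j+1$; (R6) $v_ih_{i+1}h_i=h_iv_{i+1}v_i\sigma_{i+1}$ for $i\ge0$.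
   Context: $\mathbb N=\{0,1,2,\dots\}$. For $i\in\mathbb N$ let $S_i=[2i,2i+1]\times[0,1]$. Let $C\subset[0,1]$ be the usual middle-thirds Cantor set and $Y=\bigcup_{i\in\mathbb N}(2i+C)\times C$, so that $Y\cap S_i$ is a copy of $C\times C$ in $S_i$. The trivial pattern is $\{S_i\mid i\in\mathbb N\}$. A simple increment of a pattern replaces one rectangle $R$ of the pattern either by its (closed) left third and right third (vertical division) or by its (closed) bottom third and top third (horizontal division), leaving the other rectangles alone. A pattern is a set of rectangles obtainable from the trivial pattern by finitely many simple increments. A numbered pattern is a bijection from $\mathbb N$ to the rectangles of a pattern for which there are $j,k\in\mathbb N$ such that for every $i>k$ the square $S_i$ contains only one rectangle of the pattern and its number is $i+j$. A pair $(P,Q)$ of numbered patterns defines a homeomorphism of $Y$: for each $i$, it takes the intersection of $Y$ with the $i$-th rectangle of $Q$ onto the intersection of $Y$ with the $i$-th rectangle of $P$ by the unique affine map of the form $(x,y)\mapsto(a+3^jx,b+3^ky)$, $j,k\in\mathbb Z$, that does so. The group $\widehat{2V}$ is the set of all homeomorphisms of $Y$ obtained this way, under composition (acting on the left, composed right to left). Let $E$ be the trivial pattern with $S_i$ numbered $i$. A numbered pattern $P$ is identified with the element $(P,E)$ of $\widehat{2V}$, so that $(P,Q)=PQ^{-1}$. Special elements, for $i\in\mathbb N$: $v_i$ is the numbered pattern (element) in which $S_i$ is divided vertically, with left piece numbered $i$ and right piece numbered $i+1$, and every $S_j$ with $j\neq i$ is a single rectangle, numbered $j$ if $j<i$ and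 $j+1$ if $j>i$. $h_i$ is defined in the same way with $S_i$ divided horizontally, the bottom piece numbered $i$ and the top piece numbered $i+1$. $\sigma_i$ is the trivial pattern with $S_i$ numbered $i+1$, $S_{i+1}$ numbered $i$, and $S_j$ numbered $j$ for $j\notin\{i,i+1\}$. *)

theory Defs
  imports "HOL-Analysis.Analysis" "HOL-Algebra.Algebra"
begin

section \<open>Free groups and group presentations\<close>

text \<open>A letter \<open>(s, True)\<close> stands for the generator \<open>s\<close>, and \<open>(s, False)\<close> for its inverse.
  The elements of the free group are the freely reduced words.\<close>

type_synonym 'a word = "('a \<times> bool) list"

fun inv_letter :: "'a \<times> bool \<Rightarrow> 'a \<times> bool" where
  "inv_letter (s, b) = (s, \<not> b)"

definition reduced :: "'a word \<Rightarrow> bool" where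
  "reduced w \<longleftrightarrow> successively (\<lambda>x y. y \<noteq> inv_letter x) w"

fun red_Cons :: "'a \<times> bool \<Rightarrow> 'a word \<Rightarrow> 'a word" where
  "red_Cons x [] = [x]"
| "red_Cons x (y # w) = (if y = inv_letter x then w else x # y # w)"

definition free_group :: "'a word monoid" where
  "free_group = \<lparr>carrier = {w. reduced w}, mult = foldr red_Cons, one = []\<rparr>"

definition normal_closure :: "('g, 'm) monoid_scheme \<Rightarrow> 'g set \<Rightarrow> 'g set" where
  "normal_closure G A = (\<lambda>N. N \<lhd> G) hull A"

definition relators :: "('a word \<times> 'a word) set \<Rightarrow> 'a word set" where
  "relators R = {l \<otimes>\<^bsub>free_group\<^esub> inv\<^bsub>free_group\<^esub> r | l r. (l, r) \<in> R}"

definition presented_group :: "('a word \<times> 'a word) set \<Rightarrow> 'a word set monoid" where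
  "presented_group R = free_group Mod normal_closure free_group (relators R)"

definition generator_class :: "('a word \<times> 'a word) set \<Rightarrow> 'a \<Rightarrow> 'a word set" where
  "generator_class R s = normal_closure free_group (relators R) #>\<^bsub>free_group\<^esub> [(s, True)]"

text \<open>The group \<open>G\<close> is presented by the generators \<open>g s\<close>, where \<open>s\<close> ranges over the whole
  type \<open>'a\<close>, and the relations \<open>l = r\<close> for \<open>(l, r) \<in> R\<close>.\<close>

definition is_presented_by ::
    "('g, 'm) monoid_scheme \<Rightarrow> ('a \<Rightarrow> 'g) \<Rightarrow> ('a word \<times> 'a word) set \<Rightarrow> bool" where
  "is_presented_by G g R \<longleftrightarrow>
     group G \<and> (\<exists>\<phi> \<in> iso (presented_group R) G. \<forall>s. \<phi> (generator_class R s) = g s)"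

lemma inv_letter_inv_letter [simp]: "inv_letter (inv_letter x) = x"
  by (cases x) auto

lemma inv_letter_neq [simp]: "inv_letter x \<noteq> x" "x \<noteq> inv_letter x"
  by (cases x; auto)+

lemma reduced_Nil [simp]: "reduced []"
  by (simp add: reduced_def)

lemma reduced_Cons: "reduced (x # w) \<longleftrightarrow> reduced w \<and> (w = [] \<or> hd w \<noteq> inv_letter x)"
  by (cases w) (auto simp: reduced_def)

lemma reduced_red_Cons: "reduced w \<Longrightarrow> reduced (red_Cons x w)"
  by (cases w) (auto simp: reduced_Cons)

lemma reduced_foldr: "reduced w \<Longrightarrow> reduced (foldr red_Cons u w)"
  by (induction u) (auto intro: reduced_red_Cons)

lemma red_Cons_cancel: "reduced w \<Longrightarrow> red_Cons x (red_Cons (inv_letter x) w) = w"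
  by (cases w rule: remdups_adj.cases) (auto simp: reduced_Cons)

lemma red_Cons_cancel': "reduced w \<Longrightarrow> red_Cons (inv_letter x) (red_Cons x w) = w"
  using red_Cons_cancel[of w "inv_letter x"] by simp

lemma foldr_red_Cons: "reduced w \<Longrightarrow>
    foldr red_Cons (red_Cons x u) w = red_Cons x (foldr red_Cons u w)"
  by (cases u) (auto simp: red_Cons_cancel reduced_foldr)

lemma foldr_assoc: "reduced w \<Longrightarrow>
    foldr red_Cons (foldr red_Cons u v) w = foldr red_Cons u (foldr red_Cons v w)"
  by (induction u) (auto simp: foldr_red_Cons)

lemma foldr_reduced: "reduced w \<Longrightarrow> foldr red_Cons w [] = w"
proof (induction w)
  case (Cons x w)
  then show ?case by (cases w) (auto simp: reduced_Cons)
qed simp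

lemma foldr_inverse: "reduced w \<Longrightarrow>
    foldr red_Cons (foldr red_Cons (rev (map inv_letter w)) []) w = []"
proof -
  have "foldr red_Cons (rev (map inv_letter w)) (w @ v) = v" for v
    by (induction w arbitrary: v) auto
  from this[of "[]"] show "reduced w \<Longrightarrow> ?thesis"
    by (simp add: foldr_assoc)
qed

lemma group_free_group: "group free_group"
proof (rule groupI)
  fix x :: "'a word"
  assume x: "x \<in> carrier free_group"
  then show "\<exists>y\<in>carrier free_group. y \<otimes>\<^bsub>free_group\<^esub> x = \<one>\<^bsub>free_group\<^esub>"
    by (intro bexI[of _ "foldr red_Cons (rev (map inv_letter x)) []"])
      (auto simp: free_group_def foldr_inverse intro: reduced_foldr)
qed (auto simp: free_group_def foldr_assoc intro: reduced_foldr)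


section \<open>The group\<close>

type_synonym point = "real \<times> real"

definition rect :: "real \<Rightarrow> real \<Rightarrow> real \<Rightarrow> real \<Rightarrow> point set" where
  "rect a b c d = {a..b} \<times> {c..d}"

definition square :: "nat \<Rightarrow> point set" where
  "square i = rect (2 * real i) (2 * real i + 1) 0 1"

primrec cantor_stage :: "nat \<Rightarrow> real set" where
  "cantor_stage 0 = {0..1}"
| "cantor_stage (Suc n) =
     (\<lambda>x. x / 3) ` cantor_stage n \<union> (\<lambda>x. 2 / 3 + x / 3) ` cantor_stage n"

definition cantor :: "real set" where
  "cantor = (\<Inter>n. cantor_stage n)"

definition Y :: "point set" where
  "Y = (\<Union>i::nat. ((\<lambda>x. 2 * real i + x) ` cantor) \<times> cantor)"

text \<open>The divided rectangle is nondegenerate, so that its coordinates are determined by it.\<close>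

inductive simple_increment :: "point set set \<Rightarrow> point set set \<Rightarrow> bool" where
  vertical: "\<lbrakk>a < b; c < d; rect a b c d \<in> p\<rbrakk> \<Longrightarrow> simple_increment p
      ((p - {rect a b c d}) \<union> {rect a (a + (b - a) / 3) c d, rect (b - (b - a) / 3) b c d})"
| horizontal: "\<lbrakk>a < b; c < d; rect a b c d \<in> p\<rbrakk> \<Longrightarrow> simple_increment p
      ((p - {rect a b c d}) \<union> {rect a b c (c + (d - c) / 3), rect a b (d - (d - c) / 3) d})"

definition is_pattern :: "point set set \<Rightarrow> bool" where
  "is_pattern p \<longleftrightarrow> simple_increment\<^sup>*\<^sup>* (range square) p"

definition numbered_pattern :: "(nat \<Rightarrow> point set) \<Rightarrow> bool" where
  "numbered_pattern P \<longleftrightarrow>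
     (\<exists>p. is_pattern p \<and> bij_betw P UNIV p) \<and>
     (\<exists>j k. \<forall>i>k. {n. P n \<subseteq> square i} = {i + j})"

definition pair_map :: "(nat \<Rightarrow> point set) \<Rightarrow> (nat \<Rightarrow> point set) \<Rightarrow> point \<Rightarrow> point" where
  "pair_map P Q = (THE f. f \<in> extensional Y \<and>
     (\<forall>i. f ` (Y \<inter> Q i) = Y \<inter> P i \<and>
        (\<exists>(a::real) (b::real) (j::int) (k::int). \<forall>(x, y) \<in> Y \<inter> Q i.
            f (x, y) = (a + 3 powi j * x, b + 3 powi k * y))))"

definition two_V_hat :: "(point \<Rightarrow> point) monoid" where
  "two_V_hat = (BijGroup Y)\<lparr>carrier :=
     {f. (\<exists>f'. homeomorphism Y Y f f') \<and>
         (\<exists>P Q. numbered_pattern P \<and> numbered_pattern Q \<and> f = pair_map P Q)}\<rparr>"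

definition pattern_element :: "(nat \<Rightarrow> point set) \<Rightarrow> point \<Rightarrow> point" where
  "pattern_element P = pair_map P square"


section \<open>Generators and relations\<close>

definition v_pattern :: "nat \<Rightarrow> nat \<Rightarrow> point set" where
  "v_pattern i n =
     (if n < i then square n
      else if n = i then rect (2 * real i) (2 * real i + 1 / 3) 0 1
      else if n = i + 1 then rect (2 * real i + 2 / 3) (2 * real i + 1) 0 1
      else square (n - 1))"

definition h_pattern :: "nat \<Rightarrow> nat \<Rightarrow> point set" where
  "h_pattern i n =
     (if n < i then square n
      else if n = i then rect (2 * real i) (2 * real i + 1) 0 (1 / 3)
      else if n = i + 1 then rect (2 * real i) (2 * real i + 1) (2 / 3) 1
      else square (n - 1))"

text \<open>The argument of a numbered pattern is the number, so this is the pattern in which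
  \<open>square i\<close> is numbered \<open>i + 1\<close> and \<open>square (i + 1)\<close> is numbered \<open>i\<close>.\<close>

definition \<sigma>_pattern :: "nat \<Rightarrow> nat \<Rightarrow> point set" where
  "\<sigma>_pattern i n =
     (if n = i + 1 then square i else if n = i then square (i + 1) else square n)"

datatype direction = Vertical | Horizontal

datatype generator = Divide direction nat | Swap nat

fun generator_element :: "generator \<Rightarrow> point \<Rightarrow> point" where
  "generator_element (Divide Vertical i) = pattern_element (v_pattern i)"
| "generator_element (Divide Horizontal i) = pattern_element (h_pattern i)"
| "generator_element (Swap i) = pattern_element (\<sigma>_pattern i)"

abbreviation positive_word :: "'a list \<Rightarrow> 'a word" where
  "positive_word \<equiv> map (\<lambda>s. (s, True))"

text \<open>A pair \<open>(l, r)\<close> of lists of generators stands for the relation \<open>l = r\<close> between products.\<close>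

inductive_set relations :: "(generator list \<times> generator list) set" where
  R1: "i < j \<Longrightarrow>
    ([Divide x j, Divide y i], [Divide y i, Divide x (j + 1)]) \<in> relations"
| R2: "([Swap i, Swap i], []) \<in> relations"
| R3: "2 \<le> \<bar>int i - int j\<bar> \<Longrightarrow> ([Swap i, Swap j], [Swap j, Swap i]) \<in> relations"
| R4: "([Swap i, Swap (i + 1), Swap i], [Swap (i + 1), Swap i, Swap (i + 1)]) \<in> relations"
| R5a: "i < j \<Longrightarrow>
    ([Swap j, Divide x i], [Divide x i, Swap (j + 1)]) \<in> relations"
| R5b: "i = j \<Longrightarrow>
    ([Swap j, Divide x i], [Divide x (j + 1), Swap j, Swap (j + 1)]) \<in> relations"
| R5c: "i = j + 1 \<Longrightarrow>
    ([Swap j, Divide x i], [Divide x j, Swap (j + 1), Swap j]) \<in> relations"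
| R5d: "i > j + 1 \<Longrightarrow>
    ([Swap j, Divide x i], [Divide x i, Swap j]) \<in> relations"
| R6: "([Divide Vertical i, Divide Horizontal (i + 1), Divide Horizontal i],
    [Divide Horizontal i, Divide Vertical (i + 1), Divide Vertical i, Swap (i + 1)]) \<in> relations"

end

theory Submission
  imports Defs
begin

text \<open>The rectangles that occur in patterns have addresses: the number of a square and, for each
  direction, a binary word that says which thirds to take. A positive word \<open>w\<close> in the generators
  acts on addresses, and the rectangles \<open>w \<cdot> S\<^sub>k\<close>, \<open>k \<in> \<nat>\<close>, form the numbered
  pattern of \<open>w\<close>. The theorem says that the group is the group of right fractions of the monoid of
  positive words modulo the relations, and it rests on three facts about this monoid.

  \<^item> \<^emph>\<open>It is faithfully represented by numbered patterns\<close> (\<open>equal_words_iff_acts\<close>). The key step is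
    \<open>divided_imp_divide\<close>: if in the pattern of \<open>w\<close> the square \<open>S\<^sub>i\<close> is cut in direction
    \<open>x\<close>, in the sense that no rectangle in it has full extent in that direction, then the relations
    turn \<open>w\<close> into a word that begins with the division \<open>x\<^sub>i\<close>. The generator is pulled to
    the front letter by letter, and where the first letter divides \<open>S\<^sub>i\<close> in the other direction, the
    relation R6 exchanges the two directions. Cancelling \<open>x\<^sub>i\<close> reduces the
    comparison of two words with the same pattern to shorter words, and finally to words in the
    transpositions. For these, R2, R3 and R4 are the Coxeter presentation of the finitary symmetric group.

  \<^item> \<^emph>\<open>Common right multiples exist\<close> (\<open>ex_common_refinement\<close>). If all of the rectangles of a pattern
    that can lie in \<open>S\<^sub>i\<close> are divided in direction \<open>x\<close>, then \<open>S\<^sub>i\<close> is cut in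
    direction \<open>x\<close>, and the key step applies. Hence in every group in which the relations hold, each
    product of generators and their inverses is a fraction \<open>p q\<inverse>\<close> of positive words.

  \<^item> \<^emph>\<open>Every numbered pattern is the pattern of a word\<close> (\<open>numbered_pattern_imp_numbering\<close>), because
    increments of patterns are effected by divisions, and two numberings of one pattern differ by a
    permutation with finite support. Hence the homeomorphisms given by pairs of numbered patterns are exactly
    the fractions of words.

  Given these facts, an element \<open>p q\<inverse>\<close> of the presented group that acts trivially on \<open>Y\<close> satisfies
  \<open>p = q\<close> as numbered patterns, hence modulo the relations, and is trivial.\<close>

section \<open>Words and their action on addresses\<close>

text \<open>In a component of an address, \<open>False\<close> stands for the left or bottom third and \<open>True\<close> for the
  right or top third. The outermost division comes first. Indexing the components by directions lets
  one argument serve for both of them.\<close>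

type_synonym address = "nat \<times> (direction \<Rightarrow> bool list)"

fun act :: "generator \<Rightarrow> address \<Rightarrow> address" where
  "act (Divide x i) (n, c) =
     (if n < i then (n, c)
      else if n = i then (i, c(x := False # c x))
      else if n = i + 1 then (i, c(x := True # c x))
      else (n - 1, c))"
| "act (Swap i) (n, c) = (if n = i then i + 1 else if n = i + 1 then i else n, c)"

definition acts :: "generator list \<Rightarrow> address \<Rightarrow> address" where
  "acts w = foldr act w"

lemma acts_simps [simp]:
  "acts [] a = a" "acts (s # w) a = act s (acts w a)" "acts (u @ w) a = acts u (acts w a)"
  by (simp_all add: acts_def)

abbreviation whole :: "nat \<Rightarrow> address" where
  "whole k \<equiv> (k, \<lambda>_. [])"

lemma inj_act: "inj (act s)"
proof (cases s)
  case (Divide x i)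
  define undo :: "address \<Rightarrow> address" where
    "undo = (\<lambda>(n, c). if n < i then (n, c)
      else if n = i then (if hd (c x) then i + 1 else i, c(x := tl (c x))) else (n + 1, c))"
  have "undo (act s (n, c)) = (n, c)" for n c
    using Divide by (auto simp: undo_def)
  then show ?thesis by (intro inj_on_inverseI[of _ undo]) auto
next
  case (Swap i)
  then have "act s (act s (n, c)) = (n, c)" for n c by simp
  then show ?thesis by (intro inj_on_inverseI[of _ "act s"]) auto
qed

lemma inj_acts: "inj (acts w)"
proof (induction w)
  case (Cons s w)
  then show ?case
    using inj_compose[OF inj_act[of s]] by (simp add: comp_def acts_def)
qed (simp add: inj_def)

lemma act_suffix:
  "act s (n, \<lambda>x. c x @ d x) = (case act s (n, c) of (m, e) \<Rightarrow> (m, \<lambda>x. e x @ d x))"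
  by (cases s) (auto simp: fun_eq_iff)

text \<open>A word replaces the number of the square and extends or keeps the components at the front, so
  that its action is determined by the images of the whole squares.\<close>

lemma acts_suffix:
  "acts w (n, \<lambda>x. c x @ d x) = (case acts w (n, c) of (m, e) \<Rightarrow> (m, \<lambda>x. e x @ d x))"
  by (induction w) (auto simp: act_suffix split: prod.splits)

lemma acts_root: "acts w (whole n) = (m, e) \<Longrightarrow> acts w (n, d) = (m, \<lambda>x. e x @ d x)"
  using acts_suffix[of w n "\<lambda>_. []" d] by simp

text \<open>Equality in the monoid presented by the relations. Inverses do not occur here, so
  that consequences can be drawn in any group in which the relations hold.\<close>

inductive equal_words :: "generator list \<Rightarrow> generator list \<Rightarrow> bool" (infix "\<doteq>" 50) where
  relation: "(l, r) \<in> relations \<Longrightarrow> u @ l @ w \<doteq> u @ r @ w"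
| refl [simp]: "w \<doteq> w"
| sym: "u \<doteq> w \<Longrightarrow> w \<doteq> u"
| trans [trans]: "t \<doteq> u \<Longrightarrow> u \<doteq> w \<Longrightarrow> t \<doteq> w"

lemma equal_words_context:
  assumes "u \<doteq> w" shows "a @ u @ b \<doteq> a @ w @ b"
  using assms
proof induction
  case (relation l r u w)
  then show ?case using equal_words.relation[of l r "a @ u" "w @ b"] by simp
qed (auto intro: equal_words.intros)

lemma equal_words_Cons: "u \<doteq> w \<Longrightarrow> s # u \<doteq> s # w"
  using equal_words_context[of u w "[s]" "[]"] by simp

lemma equal_words_append: "u \<doteq> u' \<Longrightarrow> w \<doteq> w' \<Longrightarrow> u @ w \<doteq> u' @ w'"
  using equal_words_context[of u u' "[]" w] equal_words_context[of w w' u' "[]"]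
  by (auto intro: equal_words.trans)

lemma relation_head: "(l, r) \<in> relations \<Longrightarrow> l @ w \<doteq> r @ w"
  using equal_words.relation[of l r "[]" w] by simp

lemma act_relation:
  assumes "(l, r) \<in> relations" shows "acts l a = acts r a"
proof -
  obtain n c where a: "a = (n, c)" by fastforce
  from assms show ?thesis
  proof (cases rule: relations.cases)
    case (R1 i j x y)
    \<comment> \<open>The last case has this form to make the subtractions in \<open>act\<close> evaluate.\<close>
    consider "n < i" | "n = i" | "n = i + 1" | d where "n = i + 2 + d"
      using that(4)[of "n - i - 2"] by fastforce
    then show ?thesis using R1 by cases (simp_all add: a)
  next
    case (R3 i j)
    then have "i + 1 < j \<or> j + 1 < i" by linarith
    then show ?thesis using R3 by (elim disjE) (simp_all add: a)
  next
    case (R5a i j x)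
    consider "n < i" | "n = i" | "n = i + 1" | d where "n = i + 2 + d"
      using that(4)[of "n - i - 2"] by fastforce
    then show ?thesis using R5a by cases (simp_all add: a)
  next
    case (R5b i j x)
    consider "n \<le> j + 1" | d where "n = j + 2 + d" using that(2)[of "n - j - 2"] by fastforce
    then show ?thesis using R5b by cases (auto simp: a)
  next
    case (R5c i j x)
    consider "n \<le> j + 1" | d where "n = j + 2 + d" using that(2)[of "n - j - 2"] by fastforce
    then show ?thesis using R5c by cases (auto simp: a)
  next
    case (R5d i j x)
    consider "n < i" | "n = i" | "n = i + 1" | d where "n = i + 2 + d"
      using that(4)[of "n - i - 2"] by fastforce
    then show ?thesis using R5d by cases (simp_all add: a)
  next
    case (R6 i)
    consider "n < i" | "n = i" | "n = i + 1" | "n = i + 2" | "n = i + 3" | d where "n = i + 4 + d"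
      using less_imp_add_positive[of "i + 3" n] that(6)[of "n - i - 4"] by fastforce
    then show ?thesis using R6 by cases (simp_all add: a fun_upd_twist)
  qed (simp_all add: a)
qed

lemma acts_equal_words: "u \<doteq> w \<Longrightarrow> acts u = acts w"
  by (induction rule: equal_words.induct) (auto simp: act_relation fun_eq_iff)

primrec divisions :: "generator list \<Rightarrow> nat" where
  "divisions [] = 0"
| "divisions (s # w) = (case s of Divide x i \<Rightarrow> 1 | Swap i \<Rightarrow> 0) + divisions w"

lemma divisions_append [simp]: "divisions (u @ w) = divisions u + divisions w"
  by (induction u) auto

text \<open>All relations are homogeneous in the divisions. This is what makes inductions on the
  number of divisions possible modulo the relations.\<close>

lemma divisions_equal_words: "u \<doteq> w \<Longrightarrow> divisions u = divisions w"
proof (induction rule: equal_words.induct)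
  case (relation l r u w)
  then show ?case by (auto elim: relations.cases)
qed auto

text \<open>Each division uses up one square, and the squares far out are moved only to make up
  for this.\<close>

lemma acts_eventually_shift:
  "\<exists>N. \<forall>n\<ge>N. \<forall>c. acts w (n + divisions w, c) = (n, c)"
proof (induction w)
  case (Cons s w)
  then obtain N where N: "\<And>n c. n \<ge> N \<Longrightarrow> acts w (n + divisions w, c) = (n, c)" by blast
  show ?case
  proof (cases s)
    case (Divide x i)
    have "acts (s # w) (n + divisions (s # w), c) = (n, c)" if "n \<ge> N + i + 1" for n c
      using N[of "n + 1" c] that Divide by simp
    then show ?thesis by blast
  next
    case (Swap i)
    have "acts (s # w) (n + divisions (s # w), c) = (n, c)" if "n \<ge> N + i + 2" for n c
      using N[of n c] that Swap by simp
    then show ?thesis by blast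
  qed
qed auto

section \<open>The Coxeter presentation of the finitary symmetric group\<close>

abbreviation swap_word :: "nat \<Rightarrow> generator list \<Rightarrow> bool" where
  "swap_word n w \<equiv> set w \<subseteq> Swap ` {..<n}"

text \<open>The cycle that takes \<open>n\<close> to \<open>k\<close> and moves the numbers in between up. These cycles represent
  the cosets of the permutations of \<open>{..<n}\<close> in those of \<open>{..n}\<close>.\<close>

definition swap_run :: "nat \<Rightarrow> nat \<Rightarrow> generator list" where
  "swap_run k n = map Swap [k..<n]"

lemma swap_run_Cons: "k < n \<Longrightarrow> swap_run k n = Swap k # swap_run (Suc k) n"
  by (simp add: swap_run_def upt_conv_Cons)

lemma swap_run_append: "k \<le> j \<Longrightarrow> j \<le> n \<Longrightarrow> swap_run k n = swap_run k j @ swap_run j n"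
  unfolding swap_run_def by (metis le_Suc_ex map_append upt_add_eq_append)

lemma acts_swap_word_fix: "swap_word n w \<Longrightarrow> m > n \<Longrightarrow> acts w (m, c) = (m, c)"
  by (induction w) auto

lemma acts_swap_run: "k \<le> n \<Longrightarrow> acts (swap_run k n) (n, c) = (k, c)"
proof (induction rule: inc_induct)
  case (step k)
  then show ?case by (simp add: swap_run_Cons)
qed (simp add: swap_run_def)

lemma swap_commute_word:
  assumes "set w \<subseteq> Swap ` J" "\<And>j. j \<in> J \<Longrightarrow> 2 \<le> \<bar>int i - int j\<bar>"
  shows "Swap i # w \<doteq> w @ [Swap i]"
  using assms(1)
proof (induction w)
  case (Cons s w)
  then obtain j where j: "s = Swap j" "j \<in> J" by auto
  have "Swap i # s # w \<doteq> s # Swap i # w"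
    using relation_head[OF relations.R3[OF assms(2)[OF j(2)]], of w] j by simp
  also have "\<dots> \<doteq> s # w @ [Swap i]" using Cons by (intro equal_words_Cons) auto
  finally show ?case by simp
qed simp

text \<open>Multiplication by a generator permutes the cosets that the runs represent, and
  the relations suffice to see it. The braid relation is used when the generator lies inside the run: it passes
  through the run and comes out with its index lowered by one.\<close>

lemma swap_swap_run:
  assumes "k \<le> Suc n" "j \<le> n"
  shows "\<exists>k'\<le>Suc n. \<exists>u. swap_word n u \<and> Swap j # swap_run k (Suc n) \<doteq> swap_run k' (Suc n) @ u"
proof -
  have run: "set (swap_run a b) = Swap ` {a..<b}" for a b
    by (simp add: swap_run_def)
  consider "j + 1 < k" | "j + 1 = k" | "j = k" | "j > k" by linarith
  then show ?thesis
  proof cases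
    case 1
    have "Swap j # swap_run k (Suc n) \<doteq> swap_run k (Suc n) @ [Swap j]"
      by (rule swap_commute_word[of _ "{k..<Suc n}"]) (use 1 in \<open>auto simp: run\<close>)
    then show ?thesis using 1 assms by (intro exI[of _ k] exI[of _ "[Swap j]"] conjI) auto
  next
    case 2
    then have "Swap j # swap_run k (Suc n) = swap_run j (Suc n)"
      using assms by (simp add: swap_run_Cons)
    then show ?thesis using 2 assms by (intro exI[of _ j] conjI exI[of _ "[]"]) auto
  next
    case 3
    then have "Swap j # swap_run k (Suc n) = [Swap j, Swap j] @ swap_run (Suc j) (Suc n)"
      using assms by (simp add: swap_run_Cons)
    also have "\<dots> \<doteq> swap_run (Suc j) (Suc n)"
      using relation_head[OF relations.R2] by simp
    finally show ?thesis using assms by (intro exI[of _ "Suc j"] conjI exI[of _ "[]"]) auto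
  next
    case 4
    define i where "i = j - 1"
    then have i: "j = Suc i" "k \<le> i" using 4 by auto
    have split: "swap_run k (Suc n) = swap_run k i @ [Swap i, Swap j] @ swap_run (Suc j) (Suc n)"
      using i assms swap_run_append[of k i "Suc n"]
      by (simp add: swap_run_Cons[of i] swap_run_Cons[of "Suc i"])
    have "Swap j # swap_run k i \<doteq> swap_run k i @ [Swap j]"
      by (rule swap_commute_word[of _ "{k..<i}"]) (use i in \<open>auto simp: run\<close>)
    from equal_words_append[OF this equal_words.refl]
    have "Swap j # swap_run k (Suc n) \<doteq>
        swap_run k i @ [Swap j, Swap i, Swap j] @ swap_run (Suc j) (Suc n)"
      unfolding split by (metis append.assoc append_Cons append_Nil)
    also have "\<dots> \<doteq> swap_run k i @ [Swap i, Swap j, Swap i] @ swap_run (Suc j) (Suc n)"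
      using relations.R4[of i] i by (intro equal_words.sym[OF equal_words.relation]) simp
    also have "\<dots> \<doteq> swap_run k i @ [Swap i, Swap j] @ swap_run (Suc j) (Suc n) @ [Swap i]"
      using swap_commute_word[of "swap_run (Suc j) (Suc n)" "{Suc j..<Suc n}" i] i
        equal_words_context[of "Swap i # swap_run (Suc j) (Suc n)" "swap_run (Suc j) (Suc n) @ [Swap i]"
          "swap_run k i @ [Swap i, Swap j]" "[]"]
      by (auto simp: run)
    also have "\<dots> = swap_run k (Suc n) @ [Swap i]" by (simp add: split)
    finally show ?thesis using i assms by (intro exI[of _ k] conjI exI[of _ "[Swap i]"]) auto
  qed
qed

lemma swap_word_normal_form:
  assumes "swap_word (Suc n) w"
  shows "\<exists>k\<le>Suc n. \<exists>u. swap_word n u \<and> w \<doteq> swap_run k (Suc n) @ u"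
  using assms
proof (induction w)
  case Nil
  show ?case by (intro exI[of _ "Suc n"] conjI exI[of _ "[]"]) (auto simp: swap_run_def)
next
  case (Cons s w)
  then obtain k u where k: "k \<le> Suc n" "swap_word n u" "w \<doteq> swap_run k (Suc n) @ u" by auto
  from Cons.prems obtain j where j: "s = Swap j" "j \<le> n" by auto
  from swap_swap_run[OF k(1) j(2)] obtain k' u' where k': "k' \<le> Suc n" "swap_word n u'"
    "Swap j # swap_run k (Suc n) \<doteq> swap_run k' (Suc n) @ u'" by blast
  have "s # w \<doteq> s # swap_run k (Suc n) @ u" using k by (intro equal_words_Cons)
  also have "\<dots> \<doteq> swap_run k' (Suc n) @ u' @ u"
    using equal_words_append[OF k'(3) equal_words.refl[of u]] j by simp
  finally have "s # w \<doteq> swap_run k' (Suc n) @ (u' @ u)" .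
  moreover have "swap_word n (u' @ u)" using k(2) k'(2) by simp
  ultimately show ?case using k'(1) by blast
qed

text \<open>Induction on the number of generators: the leading run of a normal form is determined by
  the image of \<open>Suc n\<close>, and it can be cancelled.\<close>

lemma swap_words_equal:
  assumes "swap_word n u" "swap_word n w" "acts u = acts w"
  shows "u \<doteq> w"
  using assms
proof (induction n arbitrary: u w)
  case (Suc n)
  obtain k u' where u: "k \<le> Suc n" "swap_word n u'" "u \<doteq> swap_run k (Suc n) @ u'"
    using swap_word_normal_form[OF Suc.prems(1)] by blast
  obtain l w' where w: "l \<le> Suc n" "swap_word n w'" "w \<doteq> swap_run l (Suc n) @ w'"
    using swap_word_normal_form[OF Suc.prems(2)] by blast
  have eq: "acts (swap_run k (Suc n)) (acts u' a) = acts (swap_run l (Suc n)) (acts w' a)" for a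
    using acts_equal_words[OF u(3)] acts_equal_words[OF w(3)] Suc.prems(3) by (metis acts_simps(3))
  from eq[of "whole (Suc n)"] have "k = l"
    using u w by (simp add: acts_swap_word_fix[where n = n] acts_swap_run)
  with eq have "acts u' = acts w'"
    using inj_acts[of "swap_run l (Suc n)"] by (auto simp: inj_eq fun_eq_iff)
  then have "u' \<doteq> w'" using Suc.IH u w by blast
  then show ?case
    using u w \<open>k = l\<close> by (meson equal_words.refl equal_words.sym equal_words.trans equal_words_append)
qed auto

lemma divisions_0_swap_word:
  assumes "divisions w = 0" shows "\<exists>n. swap_word n w"
  using assms
proof (induction w)
  case (Cons s w)
  then obtain i n where "s = Swap i" "swap_word n w" by (cases s) auto
  then have "swap_word (max n (Suc i)) (s # w)" by auto
  then show ?case by blast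
qed auto

text \<open>Composing with the inverse of a run brings \<open>N\<close>, the largest number that may be moved, back to
  its place in the induction step.\<close>

lemma ex_swap_word_permutation:
  assumes "bij \<tau>" "\<And>n. n \<ge> N \<Longrightarrow> \<tau> n = n"
  shows "\<exists>w. \<forall>k c. acts w (k, c) = (\<tau> k, c)"
  using assms
proof (induction N arbitrary: \<tau>)
  case 0
  then show ?case by (intro exI[of _ "[]"]) auto
next
  case (Suc N)
  define k where "k = \<tau> N"
  have "k \<le> N"
  proof (rule ccontr)
    assume "\<not> k \<le> N"
    then have "\<tau> k = \<tau> N" using Suc.prems(2)[of k] by (simp add: k_def)
    then show False using Suc.prems(1) \<open>\<not> k \<le> N\<close> by (auto simp: bij_def inj_eq)
  qed
  define u where "u = swap_run k N"
  have "\<exists>\<pi>. bij \<pi> \<and> (\<forall>k c. acts u (k, c) = (\<pi> k, c))"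
    if "u = map Swap js" for u js
    using that
  proof (induction js arbitrary: u)
    case Nil then show ?case by (intro exI[of _ id]) (auto simp: bij_id[unfolded id_def])
  next
    case (Cons j js)
    then obtain \<pi> where "bij \<pi>" "\<And>k c. acts (map Swap js) (k, c) = (\<pi> k, c)" by blast
    then show ?case
      using Cons.prems bij_comp[OF \<open>bij \<pi>\<close> bij_transpose[of j "j + 1"]]
      by (intro exI[of _ "Transposition.transpose j (j + 1) \<circ> \<pi>"])
        (auto simp: Transposition.transpose_def comp_def)
  qed
  then obtain \<pi> where \<pi>: "bij \<pi>" "\<And>k c. acts u (k, c) = (\<pi> k, c)"
    unfolding u_def swap_run_def by blast
  have "swap_word N u" by (auto simp: u_def swap_run_def)
  then have fixed: "\<pi> n = n" if "n > N" for n
    using acts_swap_word_fix[of u N n] that \<pi>(2) by auto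
  have piN: "\<pi> N = k" using acts_swap_run[OF \<open>k \<le> N\<close>] \<pi>(2) by (simp add: u_def)
  have "bij (inv_into UNIV \<pi> \<circ> \<tau>)" using Suc.prems \<pi> by (simp add: bij_comp bij_imp_bij_inv)
  moreover have "(inv_into UNIV \<pi> \<circ> \<tau>) n = n" if "n \<ge> N" for n
    using that Suc.prems(2)[of n] fixed[of n] \<pi>(1) piN
    by (cases "n = N") (auto simp: k_def bij_def inv_f_eq)
  ultimately obtain w where w: "\<And>k c. acts w (k, c) = ((inv_into UNIV \<pi> \<circ> \<tau>) k, c)"
    using Suc.IH by blast
  have "acts (u @ w) (k, c) = (\<tau> k, c)" for k c
    using w \<pi> by (simp add: bij_def surj_f_inv_f)
  then show ?case by blast
qed

section \<open>The monoid of numbered patterns\<close>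

text \<open>The pattern of \<open>w\<close> cuts the square \<open>S\<^sub>i\<close> in direction \<open>x\<close>: a nonempty component in
  this direction means that the rectangle is contained in one of the outer thirds of the square. The rectangles need
  not have been obtained by dividing \<open>S\<^sub>i\<close> in direction \<open>x\<close> first.\<close>

definition divided :: "direction \<Rightarrow> nat \<Rightarrow> generator list \<Rightarrow> bool" where
  "divided x i w \<longleftrightarrow> (\<forall>k c. acts w (whole k) = (i, c) \<longrightarrow> c x \<noteq> [])"

text \<open>Here \<open>Divide x i\<close> is moved to the front past another generator. The index \<open>i'\<close> that it has before
  is that of the square which the other generator takes to \<open>S\<^sub>i\<close>.\<close>

lemma swap_divide:
  "\<exists>i'. (\<forall>c. act (Swap j) (i', c) = (i, c)) \<and>
     (\<forall>w. \<exists>u. Swap j # Divide x i' # w \<doteq> Divide x i # u)"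
proof -
  consider "i < j" | "i = j" | "i = j + 1" | "i > j + 1" by linarith
  then show ?thesis
  proof cases
    case 1
    then show ?thesis using relation_head[OF relations.R5a[of i j x]]
      by (intro exI[of _ i]) auto
  next
    case 2
    then show ?thesis using relation_head[OF relations.R5c[of "j + 1" j x]]
      by (intro exI[of _ "j + 1"]) auto
  next
    case 3
    then show ?thesis using relation_head[OF relations.R5b[of j j x]]
      by (intro exI[of _ j]) auto
  next
    case 4
    then show ?thesis using relation_head[OF relations.R5d[of j i x]]
      by (intro exI[of _ i]) auto
  qed
qed

lemma divide_divide:
  assumes "i \<noteq> j"
  shows "\<exists>i'. (\<forall>c. act (Divide y j) (i', c) = (i, c)) \<and>
     (\<forall>w. \<exists>u. Divide y j # Divide x i' # w \<doteq> Divide x i # u)"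
proof (cases "i < j")
  case True
  then show ?thesis using relation_head[OF relations.R1[of i j y x]]
    by (intro exI[of _ i]) auto
next
  case False
  then show ?thesis using relation_head[OF relations.R1[of j i x y]] assms
    by (intro exI[of _ "i + 1"]) (auto intro: equal_words.sym)
qed

text \<open>Dividing \<open>S\<^sub>i\<close> in one direction and both halves in the other gives four quarters, whichever
  direction comes first. R6 states this for \<open>x = Horizontal\<close>; the transposition in it is an involution
  and can be moved to the other side.\<close>

lemma cross_divide:
  assumes "x \<noteq> y"
  shows "Divide y i # Divide x i # Divide x (i + 2) # w \<doteq>
    Divide x i # Divide y (i + 1) # Divide y i # Swap (i + 1) # w"
proof -
  have swap: "[Divide y i, Divide x i, Divide x (i + 2)] @ w \<doteq>
      [Divide y i, Divide x (i + 1), Divide x i] @ w"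
    using equal_words.relation[OF relations.R1[of i "i + 1" x x], of "[Divide y i]" w]
    by (auto intro: equal_words.sym)
  have R2: "u @ [Swap (i + 1), Swap (i + 1)] @ w \<doteq> u @ w" for u
    using equal_words.relation[OF relations.R2[of "i + 1"], of u w] by simp
  have "[Divide y i, Divide x (i + 1), Divide x i] @ w \<doteq>
      [Divide x i, Divide y (i + 1), Divide y i, Swap (i + 1)] @ w"
  proof (cases "y = Vertical")
    case True
    with assms have "x = Horizontal" by (cases x) auto
    with True show ?thesis using relation_head[OF relations.R6[of i], of w] by simp
  next
    case False
    then have xy: "y = Horizontal" "x = Vertical" using assms by (cases x; cases y; auto)+
    have "[Divide y i, Divide x (i + 1), Divide x i] @ w \<doteq>
        [Divide y i, Divide x (i + 1), Divide x i] @ [Swap (i + 1), Swap (i + 1)] @ w"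
      by (rule equal_words.sym[OF R2])
    also have "\<dots> \<doteq> [Divide x i, Divide y (i + 1), Divide y i] @ Swap (i + 1) # w"
      using relation_head[OF relations.R6[of i], of "Swap (i + 1) # w"] xy
      by (auto intro: equal_words.sym)
    finally show ?thesis by simp
  qed
  with swap show ?thesis by (auto intro: equal_words.trans)
qed

text \<open>Consider the first letter of \<open>w\<close>. If it is a transposition or divides another square,
  then the rest of \<open>w\<close> cuts the square that is taken to \<open>S\<^sub>i\<close>, and by induction the desired division can be
  brought to the front of the rest and past the first letter. If it divides \<open>S\<^sub>i\<close> in the other
  direction, then the rest of \<open>w\<close> cuts both \<open>S\<^sub>i\<close> and \<open>S\<^sub>i\<^sub>+\<^sub>1\<close>. Two divisions come to the front,
  and \<open>cross_divide\<close> exchanges the directions. The second of these divisions comes out of a word that is known only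
  modulo the relations and may be long. So the induction is on the number of divisions first, and
  on the length only second.\<close>

lemma divided_imp_divide:
  "divided x i w \<Longrightarrow> \<exists>u. w \<doteq> Divide x i # u"
proof (induction "(divisions w, length w)" arbitrary: w i
    rule: wf_induct_rule[OF wf_lex_prod[OF wf_less_than wf_less_than]])
  case (1 w i)
  have IH: "\<exists>u'. u \<doteq> Divide x i' # u'"
    if "divided x i' u" "divisions u < divisions w \<or> divisions u = divisions w \<and> length u < length w"
    for u i' using 1 that by auto
  show ?case
  proof (cases w)
    case Nil
    then show ?thesis using 1(2) by (auto simp: divided_def)
  next
    case (Cons s w1)
    note w = this
    show ?thesis
    proof (cases s)
      case (Swap j)
      obtain i' where i': "\<forall>c. act (Swap j) (i', c) = (i, c)"
        and ex: "\<forall>w. \<exists>u. Swap j # Divide x i' # w \<doteq> Divide x i # u"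
        using swap_divide by blast
      have "divided x i' w1" using \<open>divided x i w\<close> i' unfolding divided_def w Swap acts_simps by metis
      then obtain u where "w1 \<doteq> Divide x i' # u" using IH w Swap by fastforce
      then have "w \<doteq> Swap j # Divide x i' # u" using w Swap by (simp add: equal_words_Cons)
      then show ?thesis using ex by (blast intro: equal_words.trans)
    next
      case (Divide y j)
      consider "j \<noteq> i" | "j = i" "x = y" | "j = i" "x \<noteq> y" by blast
      then show ?thesis
      proof cases
        case 1
        obtain i' where i': "\<forall>c. act (Divide y j) (i', c) = (i, c)"
          and ex: "\<forall>w. \<exists>u. Divide y j # Divide x i' # w \<doteq> Divide x i # u"
          using divide_divide[of i j] 1 by blast
        have "divided x i' w1" using \<open>divided x i w\<close> i' unfolding divided_def w Divide acts_simps by metis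
        then obtain u where "w1 \<doteq> Divide x i' # u" using IH w Divide by fastforce
        then have "w \<doteq> Divide y j # Divide x i' # u" using w Divide by (simp add: equal_words_Cons)
        then show ?thesis using ex by (blast intro: equal_words.trans)
      next
        case 2
        then show ?thesis using w Divide by (intro exI[of _ w1]) simp
      next
        case 3
        \<comment> \<open>\<open>y\<^sub>i\<close> takes the squares \<open>S\<^sub>i\<close> and \<open>S\<^sub>i\<^sub>+\<^sub>1\<close> to the two halves of \<open>S\<^sub>i\<close> without
          changing the component in the direction \<open>x\<close>.\<close>
        have half: "divided x (i + of_bool b) w1" for b
          unfolding divided_def
        proof (intro allI impI)
          fix k c assume "acts w1 (whole k) = (i + of_bool b, c)"
          then have "acts w (whole k) = (i, c(y := b # c y))"
            using w Divide 3 by (cases b) simp_all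
          then have "(c(y := b # c y)) x \<noteq> []"
            using \<open>divided x i w\<close> unfolding divided_def by blast
          then show "c x \<noteq> []" using 3 by simp
        qed
        obtain u where u: "w1 \<doteq> Divide x i # u" using IH half[of False] w Divide by fastforce
        \<comment> \<open>Once \<open>x\<^sub>i\<close> has been split off, the square \<open>S\<^sub>i\<^sub>+\<^sub>1\<close> of \<open>w1\<close> has index \<open>i + 2\<close>.\<close>
        have "divided x (i + 2) u"
          unfolding divided_def
        proof (intro allI impI)
          fix k c assume "acts u (whole k) = (i + 2, c)"
          then have "acts w1 (whole k) = (i + 1, c)" using acts_equal_words[OF u] by simp
          then show "c x \<noteq> []" using half[of True] by (simp add: divided_def)
        qed
        moreover have "divisions u < divisions w"
          using divisions_equal_words[OF u] w Divide by simp
        ultimately obtain t where t: "u \<doteq> Divide x (i + 2) # t" using IH by blast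
        have "w \<doteq> Divide y i # Divide x i # Divide x (i + 2) # t"
          using u t w Divide 3 by (auto intro: equal_words.trans equal_words_Cons)
        then show ?thesis using cross_divide[OF 3(2)] by (blast intro: equal_words.trans)
      qed
    qed
  qed
qed

lemma ex_leading_division:
  "divisions w \<noteq> 0 \<Longrightarrow> \<exists>x i u. w \<doteq> Divide x i # u"
proof (induction w)
  case (Cons s w)
  show ?case
  proof (cases s)
    case (Swap j)
    then obtain x i' u where w: "w \<doteq> Divide x i' # u" using Cons by auto
    obtain i where "\<exists>u'. Swap j # Divide x i' # u \<doteq> Divide x i # u'"
    proof -
      define i where "i = fst (act (Swap j) (whole i'))"
      have i: "fst (act (Swap j) (whole i)) = i'" by (simp add: i_def)
      obtain i'' where i'': "\<forall>c. act (Swap j) (i'', c) = (i, c)"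
        "\<forall>w. \<exists>u. Swap j # Divide x i'' # w \<doteq> Divide x i # u"
        using swap_divide by blast
      then have "i'' = i'" using i spec[OF i''(1), of "\<lambda>_. []"] by (auto split: if_splits)
      then show ?thesis using i''(2) that by blast
    qed
    then show ?thesis using w Swap by (meson equal_words_Cons equal_words.trans)
  next
    case (Divide x i)
    then show ?thesis using equal_words.refl by blast
  qed
qed simp

text \<open>Induction on the number of divisions. A division \<open>x\<^sub>i\<close> at the front of \<open>u\<close> is visible in
  the pattern, so \<open>w\<close> can be given the same first letter, which acts injectively and can be
  cancelled.\<close>

lemma equal_words_iff_acts: "u \<doteq> w \<longleftrightarrow> (\<forall>k. acts u (whole k) = acts w (whole k))"
proof
  show "u \<doteq> w" if "\<forall>k. acts u (whole k) = acts w (whole k)"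
    using that
  proof (induction "divisions u" arbitrary: u w)
    case 0
    obtain N where N: "\<And>n. n \<ge> N \<Longrightarrow> acts u (whole n) = whole n"
      using acts_eventually_shift[of u] 0(1) by auto
    obtain M where M: "\<And>n. n \<ge> M \<Longrightarrow> acts w (whole (n + divisions w)) = whole n"
      using acts_eventually_shift[of w] by auto
    have "divisions w = 0"
      using N[of "N + M + divisions w"] M[of "N + M"] 0(2) by auto
    then obtain m n where mn: "swap_word m u" "swap_word n w"
      using divisions_0_swap_word 0(1) by metis
    moreover have "acts u (k, c) = acts w (k, c)" for k c
      using 0(2) acts_root[of u k _ _ c] acts_root[of w k _ _ c] by (metis surj_pair)
    then have "acts u = acts w" by auto
    moreover have "swap_word (max m n) u" "swap_word (max m n) w" using mn by force+
    ultimately show ?case using swap_words_equal by blast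
  next
    case (Suc d)
    obtain x i u' where u: "u \<doteq> Divide x i # u'"
      using ex_leading_division Suc(2) by (metis nat.distinct(1))
    have acts_u: "acts u = acts (Divide x i # u')" by (rule acts_equal_words[OF u])
    have "divided x i u"
      unfolding divided_def acts_u
    proof (intro allI impI)
      fix k c assume "acts (Divide x i # u') (whole k) = (i, c)"
      then show "c x \<noteq> []" by (cases "acts u' (whole k)") (auto split: if_splits)
    qed
    then have "divided x i w" using Suc(3) by (simp add: divided_def)
    then obtain w' where w: "w \<doteq> Divide x i # w'" using divided_imp_divide by blast
    have "acts u' (whole k) = acts w' (whole k)" for k
      using Suc(3) acts_u acts_equal_words[OF w] injD[OF inj_act[of "Divide x i"]] by simp
    moreover have "divisions u' = d" using divisions_equal_words[OF u] Suc(2) by simp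
    ultimately have "u' \<doteq> w'" using Suc(1) by blast
    then show ?case using u w by (meson equal_words_Cons equal_words.sym equal_words.trans)
  qed
qed (simp add: acts_equal_words)

text \<open>The word \<open>q\<close> divides the first \<open>M\<close> squares in direction \<open>x\<close>. Every rectangle of the pattern of
  \<open>p q\<close> in \<open>S\<^sub>i\<close> then comes from a divided square, because \<open>p\<close> takes the remaining squares
  beyond \<open>S\<^sub>i\<close>.\<close>

lemma ex_common_refinement: "\<exists>q p'. p @ q \<doteq> Divide x i # p'"
proof -
  obtain N where N: "\<And>n c. n \<ge> N \<Longrightarrow> acts p (n + divisions p, c) = (n, c)"
    using acts_eventually_shift[of p] by blast
  define M where "M = N + i + 1 + divisions p"
  define q where "q = map (Divide x) (rev [0..<M])"
  have q: "c x \<noteq> []" if "acts (map (Divide x) (rev [0..<m])) (whole k) = (n, c)" "n < m" for m k n c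
    using that
  proof (induction m arbitrary: n c)
    case (Suc m)
    obtain n' c' where nc: "acts (map (Divide x) (rev [0..<m])) (whole k) = (n', c')" by fastforce
    then show ?case using Suc.IH[OF nc] Suc.prems by (auto split: if_splits)
  qed simp
  have "divided x i (p @ q)"
    unfolding divided_def
  proof (intro allI impI)
    fix k c assume k: "acts (p @ q) (whole k) = (i, c)"
    obtain n e where ne: "acts q (whole k) = (n, e)" by fastforce
    obtain m d where md: "acts p (whole n) = (m, d)" by fastforce
    from acts_root[OF md, of e] k ne have c: "m = i" "c = (\<lambda>x. d x @ e x)" by auto
    show "c x \<noteq> []"
    proof (cases "n < M")
      case True
      then show ?thesis using q ne c unfolding q_def by simp
    next
      case False
      then have "acts p (whole n) = whole (n - divisions p)"
        using N[of "n - divisions p" "\<lambda>_. []"] by (simp add: M_def)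
      then show ?thesis using md c False by (auto simp: M_def)
    qed
  qed
  from divided_imp_divide[OF this] show ?thesis by blast
qed

section \<open>Evaluating words in a group\<close>

definition eval_word :: "('g, 'm) monoid_scheme \<Rightarrow> ('a \<Rightarrow> 'g) \<Rightarrow> 'a word \<Rightarrow> 'g" where
  "eval_word G g w =
     foldr (\<lambda>(s, b) h. (if b then g s else inv\<^bsub>G\<^esub> g s) \<otimes>\<^bsub>G\<^esub> h) w \<one>\<^bsub>G\<^esub>"

lemma eval_word_simps [simp]:
  "eval_word G g [] = \<one>\<^bsub>G\<^esub>"
  "eval_word G g ((s, b) # w) = (if b then g s else inv\<^bsub>G\<^esub> g s) \<otimes>\<^bsub>G\<^esub> eval_word G g w"
  by (simp_all add: eval_word_def)

context group
begin

lemma eval_word_closed [simp]: "range g \<subseteq> carrier G \<Longrightarrow> eval_word G g w \<in> carrier G"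
  by (induction w) (auto simp: image_subset_iff)

lemma eval_word_append:
  "range g \<subseteq> carrier G \<Longrightarrow> eval_word G g (u @ w) = eval_word G g u \<otimes> eval_word G g w"
  by (induction u) (auto simp: image_subset_iff m_assoc)

lemma eval_word_red_Cons:
  assumes "range g \<subseteq> carrier G"
  shows "eval_word G g (red_Cons x w) = eval_word G g (x # w)"
proof (cases "\<exists>v. w = inv_letter x # v")
  case True
  then obtain v where w: "w = inv_letter x # v" by blast
  obtain s b where x: "x = (s, b)" by fastforce
  have "g s \<in> carrier G" "eval_word G g v \<in> carrier G" using assms by (auto simp: image_subset_iff)
  then show ?thesis using w x by (simp flip: m_assoc)
next
  case False
  then have "red_Cons x w = x # w" by (cases w) auto
  then show ?thesis by simp
qed

lemma eval_word_hom:
  assumes "range g \<subseteq> carrier G" shows "eval_word G g \<in> hom free_group G"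
proof (rule homI)
  fix u w
  have "eval_word G g (foldr red_Cons u w) = eval_word G g (u @ w)"
  proof (induction u)
    case (Cons x u)
    then show ?case using assms by (cases x) (simp add: eval_word_red_Cons)
  qed simp
  then show "eval_word G g (u \<otimes>\<^bsub>free_group\<^esub> w) = eval_word G g u \<otimes> eval_word G g w"
    using assms by (simp add: free_group_def eval_word_append)
qed (use assms in auto)

text \<open>The family of normal subgroups that contain \<open>A\<close> is nonempty, as \<open>carrier G\<close> belongs to it. This
  is where the hypothesis enters: an empty intersection would be \<open>UNIV\<close>.\<close>

lemma normal_closure_normal:
  assumes "A \<subseteq> carrier G" shows "normal_closure G A \<lhd> G"
proof -
  let ?\<N> = "{N. N \<lhd> G \<and> A \<subseteq> N}"
  have sub: "subgroup N G" if "N \<in> ?\<N>" for N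
    using that by (auto simp: normal_inv_iff)
  have "carrier G \<in> ?\<N>" using assms by (auto simp: normal_inv_iff subgroup_self)
  then have "subgroup (\<Inter>?\<N>) G" using sub by (intro subgroups_Inter) blast+
  moreover have "x \<otimes> h \<otimes> inv x \<in> \<Inter>?\<N>" if "x \<in> carrier G" "h \<in> \<Inter>?\<N>" for x h
    using that by (auto simp: normal_inv_iff)
  ultimately show ?thesis unfolding normal_closure_def hull_def normal_inv_iff by blast
qed

end

abbreviation eval_list :: "('g, 'm) monoid_scheme \<Rightarrow> ('a \<Rightarrow> 'g) \<Rightarrow> 'a list \<Rightarrow> 'g" where
  "eval_list G g w \<equiv> eval_word G g (positive_word w)"

lemma reduced_positive_word [simp]: "reduced (positive_word w)"
  by (induction w) (auto simp: reduced_Cons hd_map)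

text \<open>Applied to the projection onto the presented group, this expresses cosets as products of
  generator classes.\<close>

lemma hom_free_group_eq_eval:
  fixes w :: "'s word"
  assumes "group G" "\<theta> \<in> hom free_group G" "reduced w"
  shows "\<theta> w = eval_word G (\<lambda>s. \<theta> [(s, True)]) w"
proof -
  interpret group_hom free_group G \<theta>
    using assms group_free_group by (simp add: group_hom_def group_hom_axioms_def)
  show ?thesis
    using assms(3)
  proof (induction w)
    case Nil
    then show ?case using hom_one by (simp add: free_group_def)
  next
    case (Cons x w)
    obtain s b where x: "x = (s, b)" by fastforce
    have w: "reduced w" "x # w = [x] \<otimes>\<^bsub>free_group\<^esub> w"
      using Cons.prems by (cases w; simp add: free_group_def reduced_Cons)+
    have letter: "[y] \<in> carrier free_group" for y :: "'s \<times> bool"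
      by (simp add: free_group_def reduced_Cons)
    have "[(s, False)] = inv\<^bsub>free_group\<^esub> [(s, True)]"
      using letter by (intro H.inv_equality G.inv_equality[symmetric]) (simp_all add: free_group_def)
    then have "\<theta> [x] = (if b then \<theta> [(s, True)] else inv\<^bsub>G\<^esub> \<theta> [(s, True)])"
      using letter by (simp add: x hom_inv)
    moreover have "\<theta> (x # w) = \<theta> [x] \<otimes>\<^bsub>G\<^esub> \<theta> w"
      unfolding w(2) using letter w(1) by (intro hom_mult) (auto simp: free_group_def)
    ultimately show ?case using w(1) Cons.IH by (simp add: x)
  qed
qed

section \<open>Presentations by groups of fractions\<close>

context group
begin

lemma eval_list_equal_words:
  assumes "range g \<subseteq> carrier G"
    and "\<And>l r. (l, r) \<in> relations \<Longrightarrow> eval_list G g l = eval_list G g r"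
    and "u \<doteq> w"
  shows "eval_list G g u = eval_list G g w"
  using assms(3)
  by induction (simp_all add: assms(1,2) eval_word_append)

text \<open>Fractions are closed under multiplication by generators from the left. For the inverse
  of a division \<open>s\<close>, a common right multiple \<open>p q' = s p'\<close> turns \<open>s\<inverse> p\<close> into
  \<open>p' q'\<inverse>\<close>.\<close>

lemma eval_word_fraction:
  assumes g: "range g \<subseteq> carrier G"
    and rel: "\<And>l r. (l, r) \<in> relations \<Longrightarrow> eval_list G g l = eval_list G g r"
  shows "\<exists>p q. eval_word G g w = eval_list G g p \<otimes> inv eval_list G g q"
proof (induction w)
  case Nil
  show ?case by (intro exI[of _ "[]"]) simp
next
  case (Cons a w)
  obtain s b where a: "a = (s, b)" by fastforce
  from Cons obtain p q where w: "eval_word G g w = eval_list G g p \<otimes> inv eval_list G g q"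
    by blast
  have gs: "g t \<in> carrier G" for t using g by auto
  have ev: "eval_list G g u \<in> carrier G" for u using g by simp
  show ?case
  proof (cases b)
    case True
    then show ?thesis using a w gs ev by (intro exI[of _ "s # p"] exI[of _ q]) (simp add: m_assoc)
  next
    case b: False
    show ?thesis
    proof (cases s)
      case (Swap j)
      have "inv g s = g s"
        using rel[OF relations.R2[of j]] Swap gs by (intro inv_equality) simp_all
      then show ?thesis
        using a b w gs ev by (intro exI[of _ "s # p"] exI[of _ q]) (simp add: m_assoc)
    next
      case (Divide x i)
      obtain q' p' where "p @ q' \<doteq> s # p'" using ex_common_refinement Divide by blast
      from eval_list_equal_words[OF g rel this]
      have "eval_list G g p \<otimes> eval_list G g q' = g s \<otimes> eval_list G g p'"
        using g by (simp add: eval_word_append)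
      then have "eval_list G g p = g s \<otimes> eval_list G g p' \<otimes> inv eval_list G g q'"
        using gs ev by (simp add: inv_solve_right)
      then have "inv g s \<otimes> eval_list G g p = eval_list G g p' \<otimes> inv eval_list G g q'"
        using gs ev by (simp flip: m_assoc)
      then have "inv g s \<otimes> eval_word G g w =
          eval_list G g p' \<otimes> inv eval_list G g q' \<otimes> inv eval_list G g q"
        using w gs ev by (simp flip: m_assoc)
      also have "\<dots> = eval_list G g p' \<otimes> inv eval_list G g (q @ q')"
        using g ev by (simp add: eval_word_append inv_mult_group m_assoc)
      finally show ?thesis using a b by (intro exI[of _ p'] exI[of _ "q @ q'"]) simp
    qed
  qed
qed

end

text \<open>If the monoid of positive words modulo the relations embeds into \<open>G\<close>, and \<open>G\<close> consists of
  fractions of positive words, then the relations present \<open>G\<close>: in the presented group, too, every element is a fraction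
  \<open>p q\<inverse>\<close>, and if it becomes trivial in \<open>G\<close>, then \<open>p\<close> and \<open>q\<close> are equal modulo the relations.\<close>

lemma presented_by_relationsI:
  fixes G (structure) and g :: "generator \<Rightarrow> 'g"
  assumes "group G" and g: "range g \<subseteq> carrier G"
    and eq: "\<And>p q. eval_list G g p = eval_list G g q \<longleftrightarrow> p \<doteq> q"
    and fraction: "\<And>h. h \<in> carrier G \<Longrightarrow> \<exists>p q. h = eval_list G g p \<otimes> inv eval_list G g q"
  shows "is_presented_by G g (map_prod positive_word positive_word ` relations)"
proof -
  interpret group G by fact
  let ?F = "free_group :: generator word monoid"
  let ?R = "map_prod positive_word positive_word ` relations"
  let ?Q = "presented_group ?R"
  define N where "N = normal_closure ?F (relators ?R)"
  interpret F: group ?F by (rule group_free_group)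
  interpret h: group_hom ?F G "eval_word G g"
    using eval_word_hom[OF g] group_axioms F.group_axioms
    by (simp add: group_hom_def group_hom_axioms_def)
  have pos: "positive_word w \<in> carrier ?F" for w by (simp add: free_group_def)
  have relators: "relators ?R \<subseteq> carrier ?F"
    using pos by (auto simp: relators_def)
  have normal: "N \<lhd> ?F" unfolding N_def by (rule F.normal_closure_normal[OF relators])
  interpret N: normal N ?F by (rule normal)
  have Q: "?Q = ?F Mod N" by (simp add: presented_group_def N_def)
  interpret Q: group ?Q unfolding Q by (rule N.factorgroup_is_group)
  interpret c: group_hom ?F ?Q "\<lambda>w. N #>\<^bsub>?F\<^esub> w"
    using N.r_coset_hom_Mod F.group_axioms Q.group_axioms
    by (simp add: group_hom_def group_hom_axioms_def Q)
  have coset: "N #>\<^bsub>?F\<^esub> w = eval_word ?Q (generator_class ?R) w" if "reduced w" for w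
  proof -
    have "generator_class ?R = (\<lambda>s. N #>\<^bsub>?F\<^esub> [(s, True)])"
      by (simp add: fun_eq_iff generator_class_def N_def)
    then show ?thesis
      using hom_free_group_eq_eval[OF Q.group_axioms c.homh that] by simp
  qed
  have in_N: "w \<in> N \<longleftrightarrow> N #>\<^bsub>?F\<^esub> w = \<one>\<^bsub>?Q\<^esub>" if "w \<in> carrier ?F" for w
    using that N.subgroup_axioms F.coset_join1[of N w] F.coset_join2[of w N]
    by (auto simp: Q FactGroup_def N.subset)
  have gens: "range (generator_class ?R) \<subseteq> carrier ?Q"
    using c.hom_closed by (auto simp: generator_class_def N_def free_group_def reduced_Cons)
  have Qrel: "eval_list ?Q (generator_class ?R) l = eval_list ?Q (generator_class ?R) r"
    if "(l, r) \<in> relations" for l r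
  proof -
    let ?l = "positive_word l" and ?r = "positive_word r"
    have "?l \<otimes>\<^bsub>?F\<^esub> inv\<^bsub>?F\<^esub> ?r \<in> relators ?R"
      using that by (force simp: relators_def)
    then have "?l \<otimes>\<^bsub>?F\<^esub> inv\<^bsub>?F\<^esub> ?r \<in> N"
      unfolding N_def normal_closure_def using hull_subset by fast
    then have "(N #>\<^bsub>?F\<^esub> ?l) \<otimes>\<^bsub>?Q\<^esub> inv\<^bsub>?Q\<^esub> (N #>\<^bsub>?F\<^esub> ?r) = \<one>\<^bsub>?Q\<^esub>"
      using in_N pos c.hom_mult c.hom_inv by simp
    then have "N #>\<^bsub>?F\<^esub> ?l = N #>\<^bsub>?F\<^esub> ?r"
      using c.hom_closed[OF pos] Q.inv_solve_right' by fastforce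
    then show ?thesis by (simp add: coset)
  qed
  have kernel: "kernel ?F G (eval_word G g) = N"
  proof
    have "relators ?R \<subseteq> kernel ?F G (eval_word G g)"
    proof
      fix a assume "a \<in> relators ?R"
      then obtain l r where "(l, r) \<in> relations"
        and a: "a = positive_word l \<otimes>\<^bsub>?F\<^esub> inv\<^bsub>?F\<^esub> positive_word r"
        by (auto simp: relators_def)
      then have "l \<doteq> r" using relation_head[of l r "[]"] by simp
      then show "a \<in> kernel ?F G (eval_word G g)"
        using eq[of l r] pos h.hom_closed by (simp add: a kernel_def)
    qed
    then show "N \<subseteq> kernel ?F G (eval_word G g)"
      unfolding N_def normal_closure_def using h.normal_kernel by (intro hull_minimal)
    then have N_kernel: "eval_word G g w = \<one>" if "w \<in> N" for w
      using that by (auto simp: kernel_def)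
    show "kernel ?F G (eval_word G g) \<subseteq> N"
    proof
      fix w assume w: "w \<in> kernel ?F G (eval_word G g)"
      then have "reduced w" and wF: "w \<in> carrier ?F" by (auto simp: kernel_def free_group_def)
      then obtain p q where w_frac: "N #>\<^bsub>?F\<^esub> w =
          (N #>\<^bsub>?F\<^esub> positive_word p) \<otimes>\<^bsub>?Q\<^esub> inv\<^bsub>?Q\<^esub> (N #>\<^bsub>?F\<^esub> positive_word q)"
        using Q.eval_word_fraction[OF gens Qrel, of w] by (auto simp: coset)
      \<comment> \<open>The fraction was found in the presented group. Since \<open>N\<close> is contained in the kernel, it has
        the same value in \<open>G\<close> as \<open>w\<close>.\<close>
      define d where "d = positive_word p \<otimes>\<^bsub>?F\<^esub> inv\<^bsub>?F\<^esub> positive_word q"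
      have d: "d \<in> carrier ?F" using pos by (simp add: d_def)
      have w_eq: "N #>\<^bsub>?F\<^esub> w = N #>\<^bsub>?F\<^esub> d"
        unfolding w_frac d_def using pos by (simp add: c.hom_mult c.hom_inv)
      have "N #>\<^bsub>?F\<^esub> (w \<otimes>\<^bsub>?F\<^esub> inv\<^bsub>?F\<^esub> d) = \<one>\<^bsub>?Q\<^esub>"
        using c.hom_closed[OF d] by (simp only: c.hom_mult c.hom_inv F.inv_closed wF d w_eq Q.r_inv)
      then have "w \<otimes>\<^bsub>?F\<^esub> inv\<^bsub>?F\<^esub> d \<in> N" by (simp only: in_N F.m_closed F.inv_closed wF d)
      from N_kernel[OF this] have "eval_word G g w \<otimes> inv eval_word G g d = \<one>"
        by (simp only: h.hom_mult h.hom_inv F.inv_closed wF d)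
      then have "eval_word G g w = eval_word G g d"
        using h.hom_closed[OF wF] h.hom_closed[OF d] by (metis inv_equality inv_inv inv_closed)
      then have "eval_word G g d = \<one>" using w by (simp add: kernel_def)
      then have "eval_list G g p \<otimes> inv eval_list G g q = \<one>"
        unfolding d_def using pos by (simp only: h.hom_mult h.hom_inv F.inv_closed)
      then have "eval_list G g p = eval_list G g q"
        using eval_word_closed[OF g] by (metis inv_equality inv_inv inv_closed)
      then have "N #>\<^bsub>?F\<^esub> positive_word p = N #>\<^bsub>?F\<^esub> positive_word q"
        using Q.eval_list_equal_words[OF gens Qrel] eq by (simp add: coset)
      then have "N #>\<^bsub>?F\<^esub> w = \<one>\<^bsub>?Q\<^esub>"
        unfolding w_frac using c.hom_closed[OF pos] by simp
      then show "w \<in> N" using in_N wF by simp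
    qed
  qed
  have "eval_word G g ` carrier ?F = carrier G"
  proof
    show "carrier G \<subseteq> eval_word G g ` carrier ?F"
    proof
      fix a assume "a \<in> carrier G"
      then obtain p q where "a = eval_list G g p \<otimes> inv eval_list G g q" using fraction by blast
      then have "a = eval_word G g (positive_word p \<otimes>\<^bsub>?F\<^esub> inv\<^bsub>?F\<^esub> positive_word q)"
        using pos by simp
      then show "a \<in> eval_word G g ` carrier ?F"
        by (rule image_eqI) (use pos in simp)
    qed
  qed (use g in auto)
  then have "(\<lambda>C. the_elem (eval_word G g ` C)) \<in> iso ?Q G"
    using h.FactGroup_iso_set by (simp add: Q kernel)
  moreover have "the_elem (eval_word G g ` generator_class ?R s) = g s" for s
  proof -
    have s: "[(s, True)] \<in> carrier ?F" by (simp add: free_group_def reduced_Cons)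
    have "eval_word G g (n \<otimes>\<^bsub>?F\<^esub> [(s, True)]) = g s" if "n \<in> N" for n
    proof -
      have "n \<in> carrier ?F" "eval_word G g n = \<one>" using that kernel by (auto simp: kernel_def)
      moreover have "g s \<in> carrier G" using g by blast
      ultimately show ?thesis using s by (simp add: h.hom_mult)
    qed
    moreover have "generator_class ?R s = (\<lambda>n. n \<otimes>\<^bsub>?F\<^esub> [(s, True)]) ` N"
      by (auto simp: generator_class_def N_def[symmetric] r_coset_def)
    moreover have "N \<noteq> {}" using N.one_closed by blast
    ultimately have "eval_word G g ` generator_class ?R s = {g s}"
      by (simp add: image_image image_constant_conv)
    then show ?thesis by simp
  qed
  ultimately show ?thesis
    unfolding is_presented_by_def using \<open>group G\<close> by (metis (no_types, lifting))
qed

section \<open>The Cantor set\<close>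

definition third :: "bool \<Rightarrow> real \<Rightarrow> real" where
  "third b t = (if b then 2 / 3 + t / 3 else t / 3)"

lemma cantor_stage_Suc: "cantor_stage (Suc n) = third False ` cantor_stage n \<union> third True ` cantor_stage n"
  by (auto simp: third_def[abs_def])

lemma cantor_stage_subset: "cantor_stage n \<subseteq> {0..1}"
  by (induction n) (auto simp: image_subset_iff subset_iff)

lemma cantor_subset: "cantor \<subseteq> {0..1}"
  using cantor_stage_subset unfolding cantor_def by blast

lemma cantorD: "t \<in> cantor \<Longrightarrow> 0 \<le> t" "t \<in> cantor \<Longrightarrow> t \<le> 1"
  using cantor_subset by auto

lemma third_stage_iff:
  assumes "t \<in> {0..1}"
  shows "third b t \<in> cantor_stage (Suc n) \<longleftrightarrow> t \<in> cantor_stage n"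
proof -
  have "third b t = third b' s \<longleftrightarrow> b = b' \<and> t = s" if "s \<in> cantor_stage n" for b' s
    using that assms cantor_stage_subset[of n] by (cases b; cases b') (auto simp: third_def)
  then show ?thesis by (cases b) (auto simp: cantor_stage_Suc image_iff simp del: cantor_stage.simps)
qed

lemma cantor_stage_decreasing: "cantor_stage (Suc n) \<subseteq> cantor_stage n"
proof (induction n)
  case (Suc n)
  then show ?case unfolding cantor_stage_Suc by blast
qed (auto simp: image_subset_iff)

text \<open>The Cantor set is self-similar: each of its two thirds is a copy of it. The stages are decreasing, so
  that it makes no difference to leave out the first one.\<close>

lemma third_cantor_iff: "t \<in> {0..1} \<Longrightarrow> third b t \<in> cantor \<longleftrightarrow> t \<in> cantor"
  using third_stage_iff[of t b] cantor_stage_decreasing by (fastforce simp: cantor_def simp del: cantor_stage.simps)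

lemma third_cantor: "t \<in> cantor \<Longrightarrow> third b t \<in> cantor"
  using third_cantor_iff cantor_subset by blast

lemma third_less_half: "t \<in> {0..1} \<Longrightarrow> third b t < 1 / 2 \<longleftrightarrow> \<not> b"
  by (auto simp: third_def)

lemma cantor_cases:
  assumes "t \<in> cantor"
  obtains b s where "t = third b s" "s \<in> cantor" "b \<longleftrightarrow> \<not> t < 1 / 2"
proof -
  have "t \<in> cantor_stage (Suc 0)" using assms unfolding cantor_def by blast
  then obtain b s where s: "t = third b s" "s \<in> {0..1}"
    unfolding cantor_stage_Suc by auto
  then show ?thesis using that third_cantor_iff third_less_half assms by blast
qed

lemma zero_one_cantor: "0 \<in> cantor" "1 \<in> cantor"
proof -
  have "0 \<in> cantor_stage n \<and> 1 \<in> cantor_stage n" for n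
  proof (induction n)
    case (Suc n)
    then show ?case unfolding cantor_stage_Suc by (force simp: third_def)
  qed simp
  then show "0 \<in> cantor" "1 \<in> cantor" by (auto simp: cantor_def)
qed

text \<open>The affine map of the unit interval onto the interval reached by taking the thirds that the
  word names. The image of the Cantor set is a cylinder set.\<close>

primrec cylinder :: "bool list \<Rightarrow> real \<Rightarrow> real" where
  "cylinder [] t = t"
| "cylinder (b # u) t = third b (cylinder u t)"

lemma cylinder_append: "cylinder (u @ w) t = cylinder u (cylinder w t)"
  by (induction u) auto

lemma cylinder_affine: "cylinder u t = cylinder u 0 + t / 3 ^ length u"
  by (induction u) (auto simp: third_def field_simps)

lemma cylinder_mono: "s \<le> t \<Longrightarrow> cylinder u s \<le> cylinder u t"
  by (induction u) (auto simp: third_def)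

lemma cylinder_strict_mono: "s < t \<Longrightarrow> cylinder u s < cylinder u t"
  by (induction u) (auto simp: third_def)

lemma cylinder_unit: "t \<in> {0..1} \<Longrightarrow> cylinder u t \<in> {0..1}"
  by (induction u) (auto simp: third_def)

lemma cylinder_cantor_iff: "t \<in> {0..1} \<Longrightarrow> cylinder u t \<in> cantor \<longleftrightarrow> t \<in> cantor"
  by (induction u) (simp_all add: third_cantor_iff cylinder_unit del: atLeastAtMost_iff)

lemma cylinder_cantor: "t \<in> cantor \<Longrightarrow> cylinder u t \<in> cantor"
  using cylinder_cantor_iff cantor_subset by blast

lemma cylinder_onto:
  assumes "cylinder u 0 \<le> x" "x \<le> cylinder u 1"
  obtains t where "t \<in> {0..1}" "x = cylinder u t"
proof
  let ?t = "(x - cylinder u 0) * 3 ^ length u"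
  show "x = cylinder u ?t" by (subst cylinder_affine) simp
  show "?t \<in> {0..1}" using assms cylinder_affine[of u 1] by (simp add: field_simps)
qed

text \<open>The left end of the interval lies below \<open>1 / 2\<close> exactly if the first letter is \<open>False\<close>, and only the
  empty word gives an interval of length 1.\<close>

lemma cylinder_eqD:
  assumes "cylinder u 0 = cylinder w 0" "cylinder u 1 = cylinder w 1"
  shows "u = w"
  using assms
proof (induction u arbitrary: w)
  case Nil
  show ?case
  proof (cases w)
    case (Cons b v)
    then show ?thesis using Nil cylinder_unit[of 0 v] cylinder_unit[of 1 v] by (cases b) (auto simp: third_def)
  qed simp
next
  case (Cons b u)
  show ?case
  proof (cases w)
    case Nil
    then show ?thesis
      using Cons.prems cylinder_unit[of 0 u] cylinder_unit[of 1 u] by (cases b) (auto simp: third_def)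
  next
    case (Cons b' v)
    have "b = b'"
      using Cons.prems Cons third_less_half[of "cylinder u 0" b] third_less_half[of "cylinder v 0" b']
        cylinder_unit[of 0] by auto
    then show ?thesis using Cons Cons.prems Cons.IH[of v] by (auto simp: third_def split: if_splits)
  qed
qed

text \<open>The two thirds of the Cantor set are separated by \<open>1 / 2\<close>; \<open>H\<close> is the side on which the third \<open>b\<close>
  lies, and \<open>f\<close> is the inverse of \<open>third b\<close>.\<close>

lemma cylinder_open: "\<exists>U. open U \<and> cylinder u ` cantor = cantor \<inter> U"
proof (induction u)
  case Nil
  show ?case by (intro exI[of _ UNIV]) simp
next
  case (Cons b u)
  then obtain U where U: "open U" "cylinder u ` cantor = cantor \<inter> U" by blast
  define H where "H = (if b then {1/2<..} else {..<1/2::real})"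
  define f where "f x = (if b then 3 * x - 2 else 3 * x)" for x :: real
  have f: "f (third b t) = t" for t by (simp add: f_def third_def)
  have H: "third b' t \<in> H \<longleftrightarrow> b' = b" if "t \<in> cantor" for b' t
    using cantorD[OF that] by (auto simp: H_def third_def)
  have "isCont f x" for x unfolding f_def by (cases b) (simp_all add: continuous_intros)
  then have "open (f -` U)" using U(1) by (simp add: continuous_open_vimage)
  moreover have "open H" by (simp add: H_def)
  moreover have "cylinder (b # u) ` cantor = cantor \<inter> (H \<inter> f -` U)"
  proof (intro subset_antisym subsetI)
    fix x assume "x \<in> cylinder (b # u) ` cantor"
    then obtain t where "t \<in> cantor" "x = third b (cylinder u t)" by auto
    then show "x \<in> cantor \<inter> (H \<inter> f -` U)"
      using U(2) H cylinder_cantor third_cantor by (auto simp: f)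
  next
    fix x assume x: "x \<in> cantor \<inter> (H \<inter> f -` U)"
    then obtain b' s where s: "x = third b' s" "s \<in> cantor" by (blast elim: cantor_cases)
    then have "b' = b" using x H by blast
    then have "s \<in> cylinder u ` cantor" using U(2) x s f by auto
    then show "x \<in> cylinder (b # u) ` cantor" using s \<open>b' = b\<close> by auto
  qed
  ultimately show ?case by blast
qed

section \<open>Rectangles and addresses\<close>

text \<open>The affine map of the unit square onto the rectangle with the given address, in the coordinates
  \<open>z Vertical\<close> from left to right and \<open>z Horizontal\<close> from bottom to top: a vertical division is
  one of the horizontal extent.\<close>

definition place :: "address \<Rightarrow> (direction \<Rightarrow> real) \<Rightarrow> point" where
  "place = (\<lambda>(n, c) z. (2 * real n + cylinder (c Vertical) (z Vertical), cylinder (c Horizontal) (z Horizontal)))"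

definition region :: "address \<Rightarrow> point set" where
  "region = (\<lambda>(n, c). rect (2 * real n + cylinder (c Vertical) 0) (2 * real n + cylinder (c Vertical) 1)
     (cylinder (c Horizontal) 0) (cylinder (c Horizontal) 1))"

abbreviation cantors :: "(direction \<Rightarrow> real) set" where
  "cantors \<equiv> {z. range z \<subseteq> cantor}"

lemma cantorsD: "z \<in> cantors \<Longrightarrow> z x \<in> cantor"
  by auto

lemma direction_fun_eq: "z = z' \<longleftrightarrow> z Vertical = z' Vertical \<and> z Horizontal = z' Horizontal"
  by (metis (full_types) direction.exhaust ext)

lemma direction_all: "(\<forall>x. P x) \<longleftrightarrow> P Vertical \<and> P Horizontal"
  by (metis direction.exhaust)

lemma ex_cantors: "a \<in> cantor \<Longrightarrow> b \<in> cantor \<Longrightarrow> \<exists>z\<in>cantors. z Vertical = a \<and> z Horizontal = b"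
  by (intro bexI[of _ "\<lambda>x. if x = Vertical then a else b"]) auto

lemma direction_range: "range z \<subseteq> A \<longleftrightarrow> z Vertical \<in> A \<and> z Horizontal \<in> A"
  using direction_all[of "\<lambda>x. z x \<in> A"] by auto

lemma region_whole: "region (whole n) = square n"
  by (simp add: region_def square_def)

lemma place_suffix: "place (n, \<lambda>x. c x @ d x) z = place (n, c) (\<lambda>x. cylinder (d x) (z x))"
  by (simp add: place_def cylinder_append)

lemma place_whole: "place (n, c) z = place (whole n) (\<lambda>x. cylinder (c x) (z x))"
  using place_suffix[of n "\<lambda>_. []" c z] by simp

lemma place_whole_eq: "place (whole n) z = (2 * real n + z Vertical, z Horizontal)"
  by (simp add: place_def)

lemma place_in_Y: "z \<in> cantors \<Longrightarrow> place a z \<in> Y"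
  by (cases a) (simp add: place_def Y_def direction_range cylinder_cantor image_iff, blast intro: cylinder_cantor)

lemma Y_cases:
  assumes "p \<in> Y" obtains n z where "z \<in> cantors" "p = place (whole n) z"
proof -
  from assms obtain n x y where "p = (2 * real n + x, y)" "x \<in> cantor" "y \<in> cantor"
    by (auto simp: Y_def)
  moreover from this obtain z where "z \<in> cantors" "z Vertical = x" "z Horizontal = y"
    using ex_cantors by blast
  ultimately show ?thesis using that by (simp add: place_whole_eq)
qed

lemma square_index_unique:
  assumes "2 * real n + s = 2 * real m + t" "s \<in> {0..1}" "t \<in> {0..1}"
  shows "n = m" "s = t"
proof -
  have "real n < real m + 1" "real m < real n + 1" using assms by auto
  then show "n = m" by linarith
  then show "s = t" using assms by simp
qed

lemma place_whole_inj:
  assumes "place (whole n) z = place (whole m) z'" "z \<in> cantors" "z' \<in> cantors"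
  shows "n = m" "z = z'"
proof -
  have unit: "z x \<in> {0..1}" "z' x \<in> {0..1}" for x
    using assms(2,3) cantorsD cantor_subset by blast+
  show "n = m"
    using assms(1) square_index_unique(1) unit by (metis place_whole_eq fst_conv)
  then show "z = z'" using assms(1) by (simp add: place_whole_eq direction_fun_eq)
qed

text \<open>This replaces the intersections of rectangles with \<open>Y\<close>, of which the definition of \<open>pair_map\<close> speaks,
  by parametrised copies of the product of two Cantor sets.\<close>

lemma Y_inter_region: "Y \<inter> region a = place a ` cantors"
proof (intro subset_antisym subsetI)
  obtain n c where a: "a = (n, c)" by fastforce
  fix p assume p: "p \<in> Y \<inter> region a"
  then obtain m z where z: "z \<in> cantors" and pz: "p = place (whole m) z" using Y_cases by blast
  have unit: "z x \<in> {0..1}" for x using cantorsD[OF z] cantor_subset by blast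
  have pr: "2 * real n + cylinder (c Vertical) 0 \<le> 2 * real m + z Vertical"
    "2 * real m + z Vertical \<le> 2 * real n + cylinder (c Vertical) 1"
    "cylinder (c Horizontal) 0 \<le> z Horizontal" "z Horizontal \<le> cylinder (c Horizontal) 1"
    using p pz a by (auto simp: region_def rect_def place_whole_eq)
  have "real m < real n + 1" "real n < real m + 1"
    using pr unit[of Vertical] cylinder_unit[of 0 "c Vertical"] cylinder_unit[of 1 "c Vertical"] by auto
  then have m: "m = n" by linarith
  obtain s where s: "s \<in> {0..1}" "z Vertical = cylinder (c Vertical) s"
    using cylinder_onto[of "c Vertical" "z Vertical"] pr m by auto
  obtain t where t: "t \<in> {0..1}" "z Horizontal = cylinder (c Horizontal) t"
    using cylinder_onto[of "c Horizontal" "z Horizontal"] pr by auto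
  have "s \<in> cantor" "t \<in> cantor" using cantorsD[OF z] cylinder_cantor_iff s t by metis+
  then obtain z' where "z' \<in> cantors" "z' Vertical = s" "z' Horizontal = t" using ex_cantors by blast
  then show "p \<in> place a ` cantors"
    using pz a m s t by (intro image_eqI[of _ _ z']) (auto simp: place_def)
next
  obtain n c where a: "a = (n, c)" by fastforce
  fix p assume "p \<in> place a ` cantors"
  then obtain z where z: "z \<in> cantors" "p = place a z" by blast
  have "0 \<le> z x" "z x \<le> 1" for x using cantorD[OF cantorsD[OF z(1)]] by auto
  then have "p \<in> region a" by (simp add: z(2) a place_def region_def rect_def cylinder_mono)
  then show "p \<in> Y \<inter> region a" using z place_in_Y by simp
qed

text \<open>The corners \<open>(0, 0)\<close> and \<open>(1, 1)\<close> suffice to recover the address.\<close>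

lemma place_eqD:
  assumes "\<And>z. z \<in> cantors \<Longrightarrow> place a z = place b z" shows "a = b"
proof -
  obtain n c m d where [simp]: "a = (n, c)" "b = (m, d)" by fastforce
  have z: "place a (\<lambda>_. 0) = place b (\<lambda>_. 0)" "place a (\<lambda>_. 1) = place b (\<lambda>_. 1)"
    using assms zero_one_cantor by auto
  have "n = m"
    using z(1) cylinder_unit[of 0]
    by (intro square_index_unique(1)[of n "cylinder (c Vertical) 0" m "cylinder (d Vertical) 0"])
      (simp_all add: place_def)
  then show ?thesis using z cylinder_eqD[of "c _" "d _"] by (auto simp: place_def direction_fun_eq)
qed

lemma region_subset_square: "region (n, c) \<subseteq> square i \<longleftrightarrow> n = i"
proof
  assume "region (n, c) \<subseteq> square i"
  then have "(2 * real n + cylinder (c Vertical) 0, cylinder (c Horizontal) 0) \<in> square i"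
    by (auto simp: region_def rect_def cylinder_mono)
  then have "2 * real n + cylinder (c Vertical) 0 \<ge> 2 * real i" "2 * real n + cylinder (c Vertical) 0 \<le> 2 * real i + 1"
    by (auto simp: square_def rect_def)
  then have "real n < real i + 1" "real i < real n + 1" using cylinder_unit[of 0 "c Vertical"] by auto
  then show "n = i" by linarith
next
  assume "n = i"
  have "0 \<le> cylinder u 0" "cylinder u 1 \<le> 1" for u
    using cylinder_unit[of 0 u] cylinder_unit[of 1 u] by auto
  then have "{2 * real n + cylinder (c Vertical) 0..2 * real n + cylinder (c Vertical) 1}
      \<subseteq> {2 * real n..2 * real n + 1}"
    "{cylinder (c Horizontal) 0..cylinder (c Horizontal) 1} \<subseteq> {0..1}"
    by (simp_all add: atLeastatMost_subset_iff)
  then show "region (n, c) \<subseteq> square i"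
    using \<open>n = i\<close> unfolding region_def square_def rect_def prod.case by blast
qed

lemma rect_eqD:
  assumes "rect a b c d = rect a' b' c' d'" "a < b" "c < d"
  shows "a = a'" "b = b'" "c = c'" "d = d'"
proof -
  have "{a..b} \<times> {c..d} = {a'..b'} \<times> {c'..d'}" using assms(1) by (simp add: rect_def)
  then have "{a..b} = {a'..b'} \<and> {c..d} = {c'..d'}"
    unfolding times_eq_iff using assms(2,3) by auto
  then show "a = a'" "b = b'" "c = c'" "d = d'" using assms(2,3) by (auto simp: Icc_eq_Icc)
qed

lemma region_inj: "inj region"
proof (rule injI)
  fix a b assume "region a = region b"
  then have eq: "region a = region b" .
  obtain n c m d where [simp]: "a = (n, c)" "b = (m, d)" by fastforce
  have "n = m" using region_subset_square[of n c m] region_subset_square[of m d m] eq by simp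
  have lt: "cylinder u 0 < cylinder u 1" for u by (simp add: cylinder_strict_mono)
  have "rect (2 * real n + cylinder (c Vertical) 0) (2 * real n + cylinder (c Vertical) 1)
      (cylinder (c Horizontal) 0) (cylinder (c Horizontal) 1) =
    rect (2 * real n + cylinder (d Vertical) 0) (2 * real n + cylinder (d Vertical) 1)
      (cylinder (d Horizontal) 0) (cylinder (d Horizontal) 1)"
    using eq \<open>n = m\<close> by (simp add: region_def)
  from rect_eqD[OF this add_strict_left_mono[OF lt] lt]
  have "c Vertical = d Vertical" "c Horizontal = d Horizontal" by (simp_all add: cylinder_eqD)
  then show "a = b" using \<open>n = m\<close> by (simp add: direction_fun_eq)
qed

lemma place_open_in_Y: "openin (top_of_set Y) (place a ` cantors)"
proof -
  obtain n c where a: "a = (n, c)" by fastforce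
  obtain U where U: "open U" "cylinder (c Vertical) ` cantor = cantor \<inter> U" using cylinder_open by blast
  obtain U' where U': "open U'" "cylinder (c Horizontal) ` cantor = cantor \<inter> U'" using cylinder_open by blast
  \<comment> \<open>The interval isolates the square with number \<open>n\<close> from the other squares.\<close>
  define W where "W = (\<lambda>x. x - 2 * real n) -` (U \<inter> {-1/2<..<3/2}) \<times> U'"
  have "open ((\<lambda>x. x - 2 * real n) -` (U \<inter> {-1/2<..<3/2}))"
    using U by (intro continuous_open_vimage) (auto intro!: continuous_intros)
  then have "open W" using U'(1) by (simp add: W_def open_Times)
  moreover have "place a ` cantors = Y \<inter> W"
  proof (intro subset_antisym subsetI)
    fix p assume "p \<in> place a ` cantors"
    then obtain z where z: "z \<in> cantors" "p = place a z" by blast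
    then have "cylinder (c Vertical) (z Vertical) \<in> cantor \<inter> U" "cylinder (c Horizontal) (z Horizontal) \<in> U'"
      using U U' cantorsD by blast+
    then have "p \<in> W" using cantorD[of "cylinder (c Vertical) (z Vertical)"] by (auto simp: z a W_def place_def)
    then show "p \<in> Y \<inter> W" using z place_in_Y by simp
  next
    fix p assume p: "p \<in> Y \<inter> W"
    then obtain m z where z: "z \<in> cantors" and pz: "p = place (whole m) z" using Y_cases by blast
    have "2 * real m + z Vertical - 2 * real n \<in> {-1/2<..<3/2}" using p pz by (simp add: W_def place_whole_eq)
    then have "real m < real n + 1" "real n < real m + 1"
      using cantorD[OF cantorsD[OF z, of Vertical]] by auto
    then have m: "m = n" by linarith
    have "z Vertical \<in> cantor \<inter> U" "z Horizontal \<in> cantor \<inter> U'"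
      using p pz m cantorsD[OF z] by (auto simp: W_def place_whole_eq)
    then obtain s t where st: "s \<in> cantor" "t \<in> cantor" "z Vertical = cylinder (c Vertical) s"
      "z Horizontal = cylinder (c Horizontal) t"
      using U U' by blast
    then obtain z' where "z' \<in> cantors" "z' Vertical = s" "z' Horizontal = t" using ex_cantors by blast
    then show "p \<in> place a ` cantors"
      using pz a m st by (intro image_eqI[of _ _ z']) (auto simp: place_def)
  qed
  ultimately show ?thesis by (auto simp: openin_open)
qed

section \<open>Pair maps\<close>

lemma cylinder_affine_change:
  "\<exists>a j. \<forall>t. cylinder w t = a + 3 powi j * cylinder u t"
proof (intro exI allI)
  fix t :: real
  let ?j = "int (length u) - int (length w)"
  have "(3 :: real) powi ?j = 3 ^ length u / 3 ^ length w" by (simp add: power_int_diff)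
  then have "3 powi ?j * (t / 3 ^ length u) = t / 3 ^ length w" by simp
  then show "cylinder w t = (cylinder w 0 - 3 powi ?j * cylinder u 0) + 3 powi ?j * cylinder u t"
    using cylinder_affine[of w t] cylinder_affine[of u t] by (simp add: algebra_simps)
qed

text \<open>Changing the rectangle rescales each coordinate by a power of 3, as \<open>pair_map\<close> demands.\<close>

lemma place_affine_change:
  "\<exists>a b (j::int) (k::int). \<forall>z. place f z = (a + 3 powi j * fst (place g z), b + 3 powi k * snd (place g z))"
proof -
  obtain n c m d where [simp]: "f = (n, c)" "g = (m, d)" by fastforce
  obtain a j where a: "\<And>t. cylinder (c Vertical) t = a + 3 powi j * cylinder (d Vertical) t"
    using cylinder_affine_change by blast
  obtain b k where b: "\<And>t. cylinder (c Horizontal) t = b + 3 powi k * cylinder (d Horizontal) t"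
    using cylinder_affine_change by blast
  show ?thesis
    by (intro exI[of _ "2 * real n + a - 3 powi j * 2 * real m"] exI[of _ b] exI[of _ j] exI[of _ k])
      (simp add: place_def a b algebra_simps)
qed

lemma affine_image_cantor_unique:
  assumes "(\<lambda>t. a + b * t) ` cantor = (\<lambda>t. a' + b' * t) ` cantor" "b > 0" "b' > 0"
  shows "a = a'" "a + b = a' + b'"
proof -
  have "a' \<le> a \<and> a + b \<le> a' + b'"
    if eq: "(\<lambda>t. a + b * t) ` cantor = (\<lambda>t. a' + b' * t) ` cantor" and "b' > 0" for a b a' b'
  proof -
    have "a + b * 0 \<in> (\<lambda>t. a' + b' * t) ` cantor" "a + b * 1 \<in> (\<lambda>t. a' + b' * t) ` cantor"
      using zero_one_cantor unfolding eq[symmetric] by blast+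
    then obtain s t where "s \<in> cantor" "t \<in> cantor" "a = a' + b' * s" "a + b = a' + b' * t" by auto
    then show ?thesis using cantorD mult_left_le[of t b'] \<open>b' > 0\<close> by auto
  qed
  from this[OF assms(1,3)] this[OF assms(1)[symmetric] assms(2)] show "a = a'" "a + b = a' + b'" by auto
qed

text \<open>In each coordinate, an increasing affine map between cylinder sets takes the smallest point to
  the smallest and the largest to the largest, and is thereby determined.\<close>

lemma affine_on_place_unique:
  assumes image: "F ` place g ` cantors = place f ` cantors"
    and affine: "\<And>x y. (x, y) \<in> place g ` cantors \<Longrightarrow> F (x, y) = (a + 3 powi j * x, b + 3 powi k * y)"
    and z: "z \<in> cantors"
  shows "F (place g z) = place f z"
proof -
  obtain n c m d where fg: "f = (n, c)" "g = (m, d)" by fastforce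
  define p q r where "p u = cylinder u 0" "q u = (1 / 3 ^ length u :: real)" "r = (3 powi j :: real)"
    for u
  define s where "s = (3 powi k :: real)"
  have cyl: "cylinder u t = p u + q u * t" for u t
    using cylinder_affine[of u t] by (simp add: p_q_r_def)
  have pos: "q u > 0" "r > 0" "s > 0" for u by (simp_all add: p_q_r_def s_def)
  have F: "F (place g z) = (a + r * (2 * real m + p (d Vertical)) + (r * q (d Vertical)) * z Vertical,
      b + s * p (d Horizontal) + (s * q (d Horizontal)) * z Horizontal)" if "z \<in> cantors" for z
  proof -
    have "F (place g z) = (a + r * fst (place g z), b + s * snd (place g z))"
      using affine[of "fst (place g z)" "snd (place g z)"] that by (simp add: p_q_r_def s_def)
    then show ?thesis by (simp add: fg place_def cyl algebra_simps)
  qed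
  have f: "place f z = ((2 * real n + p (c Vertical)) + q (c Vertical) * z Vertical,
      p (c Horizontal) + q (c Horizontal) * z Horizontal)" for z
    by (simp add: fg place_def cyl)
  have coord: "(\<lambda>z. z x) ` cantors = cantor" for x
  proof (intro subset_antisym subsetI)
    fix t assume "t \<in> cantor"
    then show "t \<in> (\<lambda>z. z x) ` cantors" by (intro image_eqI[of _ _ "\<lambda>_. t"]) auto
  qed auto
  have proj: "h ` cantor = (\<lambda>z. h (z x)) ` cantors" for h :: "real \<Rightarrow> real" and x
  proof -
    have "(\<lambda>z. h (z x)) ` cantors = h ` ((\<lambda>z. z x) ` cantors)" by (simp only: image_image)
    also have "\<dots> = h ` cantor" by (simp only: coord)
    finally show ?thesis by simp
  qed
  have "(\<lambda>t. (a + r * (2 * real m + p (d Vertical))) + (r * q (d Vertical)) * t) ` cantor =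
      fst ` F ` place g ` cantors"
    by (subst proj[where x = Vertical])  (unfold image_image, rule image_cong, simp_all add: F)
  also have "\<dots> = (\<lambda>t. (2 * real n + p (c Vertical)) + q (c Vertical) * t) ` cantor"
    unfolding image by (subst proj[where x = Vertical]) (unfold image_image, rule image_cong, simp_all add: f)
  finally have V: "(\<lambda>t. (a + r * (2 * real m + p (d Vertical))) + (r * q (d Vertical)) * t) ` cantor = \<dots>" .
  have "(\<lambda>t. (b + s * p (d Horizontal)) + (s * q (d Horizontal)) * t) ` cantor =
      snd ` F ` place g ` cantors"
    by (subst proj[where x = Horizontal])  (unfold image_image, rule image_cong, simp_all add: F)
  also have "\<dots> = (\<lambda>t. p (c Horizontal) + q (c Horizontal) * t) ` cantor"
    unfolding image by (subst proj[where x = Horizontal]) (unfold image_image, rule image_cong, simp_all add: f)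
  finally have H: "(\<lambda>t. (b + s * p (d Horizontal)) + (s * q (d Horizontal)) * t) ` cantor = \<dots>" .
  have "a + r * (2 * real m + p (d Vertical)) = 2 * real n + p (c Vertical)"
    "r * q (d Vertical) = q (c Vertical)"
    using affine_image_cantor_unique[OF V] pos by auto
  moreover have "b + s * p (d Horizontal) = p (c Horizontal)" "s * q (d Horizontal) = q (c Horizontal)"
    using affine_image_cantor_unique[OF H] pos by auto
  ultimately show ?thesis unfolding F[OF z] f by simp
qed

lemma pair_map_eq:
  assumes cover: "Y = (\<Union>k. place (g k) ` cantors)"
    and F: "F \<in> extensional Y" "\<And>k z. z \<in> cantors \<Longrightarrow> F (place (g k) z) = place (f k) z"
  shows "pair_map (\<lambda>k. region (f k)) (\<lambda>k. region (g k)) = F"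
  unfolding pair_map_def Y_inter_region
proof (rule the_equality)
  have "F ` place (g i) ` cantors = place (f i) ` cantors" for i
    unfolding image_image by (rule image_cong) (simp_all add: F)
  moreover have "\<exists>a b (j::int) (k::int). \<forall>(x, y)\<in>place (g i) ` cantors.
      F (x, y) = (a + 3 powi j * x, b + 3 powi k * y)" for i
  proof -
    obtain a b j k where *: "\<And>z. place (f i) z = (a + 3 powi j * fst (place (g i) z), b + 3 powi k * snd (place (g i) z))"
      using place_affine_change by blast
    have "case p of (x, y) \<Rightarrow> F (x, y) = (a + 3 powi j * x, b + 3 powi k * y)"
      if "p \<in> place (g i) ` cantors" for p
      using that F(2)[of _ i] * by (auto simp: split_beta)
    then show ?thesis by blast
  qed
  ultimately show "F \<in> extensional Y \<and> (\<forall>i. F ` place (g i) ` cantors = place (f i) ` cantors \<and>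
      (\<exists>a b (j::int) (k::int). \<forall>(x, y)\<in>place (g i) ` cantors.
        F (x, y) = (a + 3 powi j * x, b + 3 powi k * y)))"
    using F(1) by blast
next
  fix F'
  assume F': "F' \<in> extensional Y \<and> (\<forall>i. F' ` place (g i) ` cantors = place (f i) ` cantors \<and>
      (\<exists>a b (j::int) (k::int). \<forall>(x, y)\<in>place (g i) ` cantors.
        F' (x, y) = (a + 3 powi j * x, b + 3 powi k * y)))"
  show "F' = F"
  proof (rule extensionalityI)
    fix p assume "p \<in> Y"
    then obtain i z where z: "z \<in> cantors" "p = place (g i) z" using cover by blast
    note F'i = spec[OF conjunct2[OF F'], of i]
    then obtain a b j k
      where *: "\<forall>(x, y)\<in>place (g i) ` cantors. F' (x, y) = (a + 3 powi j * x, b + 3 powi k * y)"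
      by (elim conjE exE) (rule that)
    have "F' ` place (g i) ` cantors = place (f i) ` cantors" using F'i by (rule conjunct1)
    moreover have "F' (x, y) = (a + 3 powi j * x, b + 3 powi k * y)" if "(x, y) \<in> place (g i) ` cantors" for x y
      using bspec[OF * that] by simp
    ultimately have "F' (place (g i) z) = place (f i) z" using z(1) by (rule affine_on_place_unique)
    then show "F' p = F p" using F(2)[OF z(1)] z(2) by simp
  qed (use F' F in auto)
qed

text \<open>The pieces are open in \<open>Y\<close>, and the map is affine on each of them.\<close>

lemma piecewise_continuous:
  assumes cover: "Y = (\<Union>k. place (g k) ` cantors)"
    and F: "\<And>k z. z \<in> cantors \<Longrightarrow> F (place (g k) z) = place (f k) z"
  shows "continuous_on Y F"
  unfolding continuous_openin_preimage_eq
proof (intro allI impI)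
  fix T :: "point set" assume "open T"
  have "openin (top_of_set Y) (place (g k) ` cantors \<inter> F -` T)" for k
  proof -
    obtain a b i j where *: "\<And>z. place (f k) z = (a + 3 powi i * fst (place (g k) z), b + 3 powi j * snd (place (g k) z))"
      using place_affine_change by blast
    have "continuous_on (place (g k) ` cantors) (\<lambda>p. (a + 3 powi i * fst p, b + 3 powi j * snd p))"
      by (intro continuous_intros)
    then have "continuous_on (place (g k) ` cantors) F"
      by (rule continuous_on_eq) (use F * in auto)
    then have "openin (top_of_set (place (g k) ` cantors)) (place (g k) ` cantors \<inter> F -` T)"
      using \<open>open T\<close> by (rule continuous_openin_preimage_gen)
    then show ?thesis using place_open_in_Y openin_trans by blast
  qed
  then have "openin (top_of_set Y) (\<Union>k. place (g k) ` cantors \<inter> F -` T)"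
    by (intro openin_Union) auto
  also have "(\<Union>k. place (g k) ` cantors \<inter> F -` T) = Y \<inter> F -` T" by (subst cover) auto
  finally show "openin (top_of_set Y) (Y \<inter> F -` T)" .
qed

lemma piecewise_homeomorphism:
  assumes cover: "Y = (\<Union>k. place (g k) ` cantors)"
    and F: "\<And>k z. z \<in> cantors \<Longrightarrow> F (place (g k) z) = place (f k) z" "bij_betw F Y Y"
  shows "homeomorphism Y Y F (inv_into Y F)"
proof (rule homeomorphismI)
  show "continuous_on Y F" using cover F(1) by (rule piecewise_continuous)
  have "Y = F ` Y" using F(2) by (simp add: bij_betw_def)
  also have "\<dots> = (\<Union>k. (\<lambda>z. F (place (g k) z)) ` cantors)"
    by (subst cover) (simp add: image_UN image_image)
  also have "\<dots> = (\<Union>k. place (f k) ` cantors)" using F(1) by auto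
  finally show "continuous_on Y (inv_into Y F)"
    by (rule piecewise_continuous[where f = g])
      (use F place_in_Y in \<open>auto simp: bij_betw_def simp flip: F(1) intro!: inv_into_f_f\<close>)
qed (use F(2) bij_betw_inv_into[OF F(2)] in \<open>auto simp: bij_betw_def f_inv_into_f\<close>)

section \<open>Words as homeomorphisms\<close>

text \<open>The action of a generator on \<open>Y\<close> in the coordinates \<open>(n, z)\<close>, where \<open>n\<close> is the number of
  the square.\<close>

fun move :: "generator \<Rightarrow> nat \<times> (direction \<Rightarrow> real) \<Rightarrow> nat \<times> (direction \<Rightarrow> real)" where
  "move (Divide x i) (n, z) =
     (if n < i then (n, z)
      else if n = i then (i, z(x := third False (z x)))
      else if n = i + 1 then (i, z(x := third True (z x)))
      else (n - 1, z))"
| "move (Swap i) (n, z) = (if n = i then i + 1 else if n = i + 1 then i else n, z)"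

lemma place_move: "place (act s (whole n)) z = (case move s (n, z) of (m, z') \<Rightarrow> place (whole m) z')"
  by (cases s) (auto simp: place_def)

text \<open>The two thirds of the Cantor set make up the whole of it, so that a divided square is filled by
  its two pieces.\<close>

lemma bij_move: "bij_betw (move s) (UNIV \<times> cantors) (UNIV \<times> cantors)"
proof (cases s)
  case (Divide x i)
  define undo where "undo = (\<lambda>(n, z).
    if n < i then (n, z)
    else if n = i then
      (if z x < 1 / 2 then (i, z(x := 3 * z x)) else (i + 1, z(x := 3 * z x - 2)))
    else (n + 1, z :: direction \<Rightarrow> real))"
  have third: "3 * third False t = t" "3 * third True t - 2 = t" for t
    by (simp_all add: third_def)
  have upd: "z(x := t) \<in> cantors" if "z \<in> cantors" "t \<in> cantor" for z t
    using that by auto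
  have undo_move: "undo (move s (n, z)) = (n, z)" if "z \<in> cantors" for n z
  proof -
    have "z x \<in> {0..1}" using cantorsD[OF that] cantor_subset by blast
    from third_less_half[OF this]
    have half: "third False (z x) < 1 / 2" "\<not> third True (z x) < 1 / 2" by simp_all
    consider "n < i" | "n = i" | "n = i + 1" | "n > i + 1" by linarith
    then show ?thesis using Divide half by cases (auto simp: undo_def third)
  qed
  have move_undo: "undo (n, z) \<in> UNIV \<times> cantors \<and> move s (undo (n, z)) = (n, z)" if z: "z \<in> cantors" for n z
  proof -
    obtain b t where t: "z x = third b t" "t \<in> cantor" "b \<longleftrightarrow> \<not> z x < 1 / 2"
      using cantor_cases[OF cantorsD[OF z]] by metis
    then have "undo (i, z) = (if b then i + 1 else i, z(x := t))"
      by (cases b) (auto simp: undo_def third)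
    moreover have "move s (if b then i + 1 else i, z(x := t)) = (i, z)"
      using Divide fun_upd_triv[of z x] unfolding t(1) by (cases b) simp_all
    ultimately have i: "undo (i, z) \<in> UNIV \<times> cantors \<and> move s (undo (i, z)) = (i, z)"
      using upd[OF z t(2)] by simp
    show ?thesis
    proof (cases "n = i")
      case False
      then show ?thesis using z Divide by (auto simp: undo_def)
    qed (use i in simp)
  qed
  have "move s (n, z) \<in> UNIV \<times> cantors" if "z \<in> cantors" for n z
    using that upd[OF that third_cantor[OF cantorsD[OF that]]] Divide by auto
  then show ?thesis
    using undo_move move_undo by (intro bij_betw_byWitness[where f' = undo]) blast+
next
  case (Swap i)
  have "move s (move s (n, z)) = (n, z)" for n z using Swap by simp
  then show ?thesis
    using Swap by (intro bij_betw_byWitness[where f' = "move s"]) auto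
qed

lemma place_whole_bij: "bij_betw (\<lambda>(n, z). place (whole n) z) (UNIV \<times> cantors) Y"
  unfolding bij_betw_def
proof
  show "inj_on (\<lambda>(n, z). place (whole n) z) (UNIV \<times> cantors)"
    by (intro inj_onI) (auto dest: place_whole_inj simp del: mem_Collect_eq)
  show "(\<lambda>(n, z). place (whole n) z) ` (UNIV \<times> cantors) = Y"
    using place_in_Y by (fastforce elim: Y_cases simp del: mem_Collect_eq)
qed

lemma cover_whole: "Y = (\<Union>k. place (whole k) ` cantors)"
  using place_whole_bij by (fastforce simp: bij_betw_def simp del: mem_Collect_eq)

lemma generator_element_eq:
  "generator_element s = pair_map (\<lambda>k. region (act s (whole k))) (\<lambda>k. region (whole k))"
proof -
  have sq: "(\<lambda>k. region (whole k)) = square" by (simp add: region_whole fun_eq_iff)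
  have "v_pattern i = (\<lambda>k. region (act (Divide Vertical i) (whole k)))" for i
    by (simp add: fun_eq_iff v_pattern_def region_whole[symmetric] region_def third_def)
  moreover have "h_pattern i = (\<lambda>k. region (act (Divide Horizontal i) (whole k)))" for i
    by (simp add: fun_eq_iff h_pattern_def region_whole[symmetric] region_def third_def)
  moreover have "\<sigma>_pattern i = (\<lambda>k. region (act (Swap i) (whole k)))" for i
    by (simp add: fun_eq_iff \<sigma>_pattern_def region_whole[symmetric] region_def)
  ultimately show ?thesis
    unfolding sq by (cases s rule: generator_element.cases) (simp_all add: pattern_element_def del: act.simps)
qed

text \<open>The action on addresses and the action on points agree for the whole squares by construction, and
  hence for all addresses, as both only affect prefixes.\<close>

lemma generator_element_Bij_act:
  "generator_element s \<in> Bij Y \<and> (\<forall>a. \<forall>z\<in>cantors. generator_element s (place a z) = place (act s a) z)"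
proof -
  let ?D = "\<lambda>(n, z). place (whole n) z" and ?A = "UNIV \<times> cantors"
  define F where "F = restrict (?D \<circ> move s \<circ> inv_into ?A ?D) Y"
  have "bij_betw (?D \<circ> move s \<circ> inv_into ?A ?D) Y Y"
    by (intro bij_betw_trans[OF bij_betw_inv_into[OF place_whole_bij]]
        bij_betw_trans[OF bij_move place_whole_bij])
  then have "bij_betw F Y Y" unfolding F_def by (simp cong: bij_betw_cong)
  then have bij: "F \<in> Bij Y" by (simp add: Bij_def F_def)
  have F_whole: "F (place (whole n) z) = place (act s (whole n)) z" if "z \<in> cantors" for n z
  proof -
    have "inv_into ?A ?D (?D (n, z)) = (n, z)"
      using that place_whole_bij by (intro inv_into_f_f) (auto simp: bij_betw_def simp del: mem_Collect_eq)
    then show ?thesis using place_in_Y[OF that] by (simp add: F_def place_move)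
  qed
  have "F (place a z) = place (act s a) z" if z: "z \<in> cantors" for a z
  proof -
    obtain n c where a: "a = (n, c)" by fastforce
    obtain m e where e: "act s (whole n) = (m, e)" by fastforce
    have "(\<lambda>x. cylinder (c x) (z x)) \<in> cantors" using z cylinder_cantor by auto
    then have "F (place a z) = place (m, e) (\<lambda>x. cylinder (c x) (z x))"
      using F_whole e by (simp add: a place_whole[of n c])
    also have "\<dots> = place (act s a) z"
      using acts_root[of "[s]" n m e c] e by (simp add: a place_suffix)
    finally show ?thesis .
  qed
  moreover have "generator_element s = F"
    unfolding generator_element_eq using bij F_whole
    by (intro pair_map_eq cover_whole) (auto simp: Bij_def)
  ultimately show ?thesis using bij by simp
qed

lemma generator_element_act:
  "z \<in> cantors \<Longrightarrow> generator_element s (place a z) = place (act s a) z"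
  using generator_element_Bij_act by blast

abbreviation word_map :: "generator list \<Rightarrow> point \<Rightarrow> point" where
  "word_map \<equiv> eval_list (BijGroup Y) generator_element"

lemma generators_in_BijGroup: "range generator_element \<subseteq> carrier (BijGroup Y)"
  using generator_element_Bij_act by (auto simp: BijGroup_def)

lemma word_map_Bij: "word_map w \<in> Bij Y"
  using group.eval_word_closed[OF group_BijGroup generators_in_BijGroup]
  by (simp add: BijGroup_def)

lemma BijGroup_mult:
  "f \<in> Bij S \<Longrightarrow> g \<in> Bij S \<Longrightarrow> f \<otimes>\<^bsub>BijGroup S\<^esub> g = compose S f g"
  by (simp add: BijGroup_def)

lemma word_map_place: "z \<in> cantors \<Longrightarrow> word_map w (place a z) = place (acts w a) z"
proof (induction w)
  case Nil
  then show ?case using place_in_Y by (simp add: BijGroup_def)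
next
  case (Cons s w)
  have "word_map (s # w) = compose Y (generator_element s) (word_map w)"
    using BijGroup_mult[OF _ word_map_Bij] generator_element_Bij_act by simp
  then show ?case
    using Cons place_in_Y[OF Cons.prems] generator_element_act[OF Cons.prems] by (simp add: compose_eq)
qed

text \<open>The faithfulness of numbered patterns, in terms of maps.\<close>

lemma word_map_eq_iff: "word_map u = word_map w \<longleftrightarrow> u \<doteq> w"
proof
  assume "word_map u = word_map w"
  then have "acts u (whole k) = acts w (whole k)" for k
    using place_eqD word_map_place by metis
  then show "u \<doteq> w" by (simp add: equal_words_iff_acts)
next
  assume "u \<doteq> w"
  show "word_map u = word_map w"
  proof (rule extensionalityI)
    fix p assume "p \<in> Y"
    then obtain n z where "z \<in> cantors" "p = place (whole n) z" using Y_cases by blast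
    then show "word_map u p = word_map w p"
      using word_map_place acts_equal_words[OF \<open>u \<doteq> w\<close>] by simp
  qed (use word_map_Bij in \<open>auto simp: Bij_def\<close>)
qed

abbreviation numbering :: "generator list \<Rightarrow> nat \<Rightarrow> point set" where
  "numbering w k \<equiv> region (acts w (whole k))"

text \<open>Both maps take the \<open>k\<close>-th rectangle of \<open>q\<close> by way of the square \<open>S\<^sub>k\<close> to the \<open>k\<close>-th rectangle of
  \<open>p\<close>.\<close>

lemma fraction_eq_pair_map:
  defines "f \<equiv> \<lambda>p q. word_map p \<otimes>\<^bsub>BijGroup Y\<^esub> inv\<^bsub>BijGroup Y\<^esub> word_map q"
  shows "f p q = pair_map (numbering p) (numbering q)"
    "homeomorphism Y Y (f p q) (inv_into Y (f p q))"
proof -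
  interpret B: group "BijGroup Y" by (rule group_BijGroup)
  have carrier: "carrier (BijGroup Y) = Bij Y" by (simp add: BijGroup_def)
  have inv: "inv\<^bsub>BijGroup Y\<^esub> word_map q \<in> Bij Y" using B.inv_closed word_map_Bij carrier by metis
  have f: "f p q \<in> Bij Y" using B.m_closed word_map_Bij inv carrier unfolding f_def by metis
  have "f p q = compose Y (word_map p) (inv\<^bsub>BijGroup Y\<^esub> word_map q)"
    unfolding f_def by (rule BijGroup_mult[OF word_map_Bij inv])
  moreover have "(inv\<^bsub>BijGroup Y\<^esub> word_map q) (place (acts q (whole k)) z) = place (whole k) z"
    if "z \<in> cantors" for k z
  proof -
    have "inv_into Y (word_map q) (word_map q (place (whole k) z)) = place (whole k) z"
      using word_map_Bij[of q] place_in_Y[OF that] by (intro inv_into_f_f) (auto simp: Bij_def bij_betw_def)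
    then show ?thesis
      using word_map_Bij place_in_Y[OF that] by (simp add: inv_BijGroup word_map_place[OF that])
  qed
  ultimately have place: "f p q (place (acts q (whole k)) z) = place (acts p (whole k)) z"
    if "z \<in> cantors" for k z
    using that place_in_Y word_map_place by (simp add: compose_eq)
  have "Y = word_map q ` Y" using word_map_Bij[of q] by (auto simp: Bij_def bij_betw_def)
  also have "\<dots> = (\<Union>k. (\<lambda>z. word_map q (place (whole k) z)) ` cantors)"
    by (subst cover_whole) (simp add: image_UN image_image)
  also have "\<dots> = (\<Union>k. place (acts q (whole k)) ` cantors)" using word_map_place by auto
  finally have cover: "Y = \<dots>" .
  show "f p q = pair_map (numbering p) (numbering q)"
    using f place by (intro pair_map_eq[symmetric, OF cover]) (auto simp: Bij_def)
  show "homeomorphism Y Y (f p q) (inv_into Y (f p q))"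
    using f place by (intro piecewise_homeomorphism[OF cover]) (auto simp: Bij_def)
qed

section \<open>Numbered patterns\<close>

definition subdivide :: "direction \<Rightarrow> bool \<Rightarrow> address \<Rightarrow> address" where
  "subdivide x b = (\<lambda>(n, c). (n, c(x := c x @ [b])))"

lemma acts_subdivide: "acts w (subdivide x b (whole i)) = subdivide x b (acts w (whole i))"
proof -
  obtain m e where e: "acts w (whole i) = (m, e)" by fastforce
  show ?thesis
    using acts_root[OF e, of "(\<lambda>_. [])(x := [b])"] e by (auto simp: subdivide_def fun_eq_iff)
qed

lemma region_subdivide:
  assumes "region r = rect a b c d" "a < b" "c < d"
  shows "region (subdivide Vertical False r) = rect a (a + (b - a) / 3) c d"
    "region (subdivide Vertical True r) = rect (b - (b - a) / 3) b c d"
    "region (subdivide Horizontal False r) = rect a b c (c + (d - c) / 3)"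
    "region (subdivide Horizontal True r) = rect a b (d - (d - c) / 3) d"
proof -
  obtain n e where r: "r = (n, e)" by fastforce
  have eq: "rect a b c d = rect (2 * real n + cylinder (e Vertical) 0) (2 * real n + cylinder (e Vertical) 1)
     (cylinder (e Horizontal) 0) (cylinder (e Horizontal) 1)"
    using assms(1) by (simp add: r region_def)
  note coords = rect_eqD[OF eq assms(2,3)]
  have cyl: "cylinder (u @ [False]) 0 = cylinder u 0" "cylinder (u @ [True]) 1 = cylinder u 1"
    "cylinder (u @ [False]) 1 = cylinder u 0 + (cylinder u 1 - cylinder u 0) / 3"
    "cylinder (u @ [True]) 0 = cylinder u 1 - (cylinder u 1 - cylinder u 0) / 3" for u
  proof -
    obtain e where e: "\<And>t. cylinder u t = cylinder u 0 + t * e"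
      by (rule that[of "1 / 3 ^ length u"], subst cylinder_affine) simp
    show "cylinder (u @ [False]) 0 = cylinder u 0" "cylinder (u @ [True]) 1 = cylinder u 1"
      "cylinder (u @ [False]) 1 = cylinder u 0 + (cylinder u 1 - cylinder u 0) / 3"
      "cylinder (u @ [True]) 0 = cylinder u 1 - (cylinder u 1 - cylinder u 0) / 3"
      using e[of "1 / 3"] e[of "2 / 3"] e[of 1] by (simp_all add: cylinder_append third_def)
  qed
  show "region (subdivide Vertical False r) = rect a (a + (b - a) / 3) c d"
    "region (subdivide Vertical True r) = rect (b - (b - a) / 3) b c d"
    "region (subdivide Horizontal False r) = rect a b c (c + (d - c) / 3)"
    "region (subdivide Horizontal True r) = rect a b (d - (d - c) / 3) d"
    by (simp_all add: r subdivide_def region_def cyl coords algebra_simps)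
qed

lemma region_nondegenerate: obtains a b c d where "region r = rect a b c d" "a < b" "c < d"
proof -
  have lt: "cylinder u 0 < cylinder u 1" for u by (simp add: cylinder_strict_mono)
  obtain n e where r: "r = (n, e)" by fastforce
  show thesis
    by (rule that[of "2 * real n + cylinder (e Vertical) 0" "2 * real n + cylinder (e Vertical) 1"
          "cylinder (e Horizontal) 0" "cylinder (e Horizontal) 1"])
      (simp_all add: r region_def lt)
qed

text \<open>Rectangles of patterns have addresses, and dividing them appends a letter. The coordinates in the
  definition of increments are recovered because the rectangles are nondegenerate.\<close>

lemma simple_increment_iff:
  assumes "p \<subseteq> range region"
  shows "simple_increment p q \<longleftrightarrow> (\<exists>x r. region r \<in> p \<and>
    q = p - {region r} \<union> {region (subdivide x False r), region (subdivide x True r)})"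
proof
  assume "simple_increment p q"
  then show "\<exists>x r. region r \<in> p \<and>
    q = p - {region r} \<union> {region (subdivide x False r), region (subdivide x True r)}"
  proof cases
    case (vertical a b c d)
    from subsetD[OF assms \<open>rect a b c d \<in> p\<close>] obtain r where r: "region r = rect a b c d"
      by (metis imageE)
    with vertical show ?thesis
      using region_subdivide(1,2)[OF r] by (intro exI[of _ Vertical] exI[of _ r]) simp
  next
    case (horizontal a b c d)
    from subsetD[OF assms \<open>rect a b c d \<in> p\<close>] obtain r where r: "region r = rect a b c d"
      by (metis imageE)
    with horizontal show ?thesis
      using region_subdivide(3,4)[OF r] by (intro exI[of _ Horizontal] exI[of _ r]) simp
  qed
next
  assume "\<exists>x r. region r \<in> p \<and>
    q = p - {region r} \<union> {region (subdivide x False r), region (subdivide x True r)}"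
  then obtain x r where r: "region r \<in> p"
    and q: "q = p - {region r} \<union> {region (subdivide x False r), region (subdivide x True r)}"
    by blast
  obtain a b c d where rect: "region r = rect a b c d" "a < b" "c < d" by (rule region_nondegenerate)
  show "simple_increment p q"
    using simple_increment.intros[of a b c d p] r rect unfolding q
    by (cases x) (simp_all add: region_subdivide[OF rect])
qed

lemma inj_numbering: "inj (numbering w)"
proof (rule injI)
  fix i k assume "numbering w i = numbering w k"
  then have "whole i = whole k" using injD[OF region_inj] injD[OF inj_acts] by blast
  then show "i = k" by simp
qed

text \<open>Appending a division on the right divides the rectangle with number \<open>i\<close> of the pattern.\<close>

lemma range_numbering_divide:
  "range (numbering (w @ [Divide x i])) = range (numbering w) - {numbering w i} \<union>
     {region (subdivide x False (acts w (whole i))), region (subdivide x True (acts w (whole i)))}"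
proof -
  have act: "act (Divide x i) (whole k) =
    (if k < i then whole k else if k = i then subdivide x False (whole i)
     else if k = i + 1 then subdivide x True (whole i) else whole (k - 1))" for k
    by (simp add: subdivide_def)
  have new: "numbering (w @ [Divide x i]) k =
    (if k < i then numbering w k else if k = i then region (subdivide x False (acts w (whole i)))
     else if k = i + 1 then region (subdivide x True (acts w (whole i))) else numbering w (k - 1))" for k
    by (simp add: act acts_subdivide del: act.simps)
  have "range (numbering w) - {numbering w i} = numbering w ` (UNIV - {i})"
    using inj_numbering[of w] by (auto simp: inj_def)
  also have "\<dots> = numbering (w @ [Divide x i]) ` ({..<i} \<union> {i + 1<..})"
  proof (intro subset_antisym subsetI)
    fix A assume "A \<in> numbering w ` (UNIV - {i})"
    then obtain k where "A = numbering w k" "k \<noteq> i" by blast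
    then have "A = numbering (w @ [Divide x i]) (if k < i then k else k + 1)" by (simp add: new)
    then show "A \<in> numbering (w @ [Divide x i]) ` ({..<i} \<union> {i + 1<..})"
      using \<open>k \<noteq> i\<close> by (auto split: if_splits)
  next
    fix A assume "A \<in> numbering (w @ [Divide x i]) ` ({..<i} \<union> {i + 1<..})"
    then obtain k where "A = numbering (w @ [Divide x i]) k" "k < i \<or> k > i + 1" by auto
    then show "A \<in> numbering w ` (UNIV - {i})" by (auto simp: new)
  qed
  also have "\<dots> \<union> {region (subdivide x False (acts w (whole i))), region (subdivide x True (acts w (whole i)))} =
      numbering (w @ [Divide x i]) ` ({..<i} \<union> {i + 1<..} \<union> {i, i + 1})"
    by (simp only: image_Un image_insert image_empty new) simp
  also have "{..<i} \<union> {i + 1<..} \<union> {i, i + 1} = UNIV" by auto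
  finally show ?thesis by simp
qed

lemma is_pattern_numbering: "is_pattern (range (numbering w))"
proof (induction w rule: rev_induct)
  case Nil
  then show ?case by (simp add: is_pattern_def region_whole)
next
  case (snoc s w)
  show ?case
  proof (cases s)
    case (Divide x i)
    have "simple_increment (range (numbering w)) (range (numbering (w @ [s])))"
      unfolding Divide range_numbering_divide
      by (subst simple_increment_iff) (auto intro!: exI[of _ x] exI[of _ "acts w (whole i)"] simp del: split_paired_Ex)
    then show ?thesis using snoc by (simp add: is_pattern_def)
  next
    case (Swap i)
    have "range (numbering (w @ [s])) = numbering w ` range (Transposition.transpose i (i + 1))"
      unfolding image_image by (rule image_cong) (auto simp: Swap Transposition.transpose_def)
    also have "\<dots> = range (numbering w)" by simp
    finally show ?thesis using snoc by simp
  qed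
qed

lemma pattern_imp_numbering: "is_pattern p \<Longrightarrow> \<exists>w. p = range (numbering w)"
  unfolding is_pattern_def
proof (induction rule: rtranclp_induct)
  case base
  show ?case by (intro exI[of _ "[]"]) (simp add: region_whole)
next
  case (step p q)
  then obtain w where w: "p = range (numbering w)" by blast
  obtain x r where r: "region r \<in> p"
    "q = p - {region r} \<union> {region (subdivide x False r), region (subdivide x True r)}"
    using step(2) simple_increment_iff[of p q] w by auto
  then obtain i where "region r = numbering w i" using w by blast
  then have "r = acts w (whole i)" by (rule injD[OF region_inj])
  then have "q = range (numbering (w @ [Divide x i]))" unfolding range_numbering_divide using r w by simp
  then show ?case by blast
qed

lemma numbering_eventually:
  "\<exists>j k. \<forall>i>k. {n. numbering w n \<subseteq> square i} = {i + j}"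
proof -
  obtain N where N: "\<And>n. n \<ge> N \<Longrightarrow> acts w (whole (n + divisions w)) = whole n"
    using acts_eventually_shift[of w] by blast
  let ?d = "divisions w"
  obtain M where M: "\<And>n. n < N + ?d \<Longrightarrow> fst (acts w (whole n)) \<le> M"
    using finite_nat_set_iff_bounded_le[of "(\<lambda>n. fst (acts w (whole n))) ` {..<N + ?d}"] by auto
  have sub: "numbering w n \<subseteq> square i \<longleftrightarrow> fst (acts w (whole n)) = i" for n i
    by (cases "acts w (whole n)") (simp add: region_subset_square)
  have "fst (acts w (whole n)) = i \<longleftrightarrow> n = i + ?d" if "i > M + N" for i n
  proof (cases "n < N + ?d")
    case True
    then show ?thesis using M[OF True] that by auto
  next
    case False
    then show ?thesis using N[of "n - ?d"] by auto
  qed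
  then have "\<forall>i>M + N. {n. numbering w n \<subseteq> square i} = {i + ?d}" unfolding sub by auto
  then show ?thesis by blast
qed

lemma numbered_pattern_numbering: "numbered_pattern (numbering w)"
  unfolding numbered_pattern_def
  using is_pattern_numbering inj_numbering numbering_eventually by (blast intro: bij_betw_imageI)

text \<open>The pattern itself is that of some word \<open>w\<close>, whose numbering differs from \<open>P\<close> by a permutation
  \<open>\<tau>\<close>. Far out, \<open>\<tau>\<close> is a shift by the difference of the two shifts \<open>j\<close> and \<open>j'\<close>, so it
  remains to see that these are equal; then \<open>\<tau>\<close> has finite support and is given by transpositions.\<close>

lemma numbered_pattern_imp_numbering:
  assumes "numbered_pattern P" shows "\<exists>w. P = numbering w"
proof -
  obtain p j k where p: "is_pattern p" "bij_betw P UNIV p"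
    and P: "\<And>i. i > k \<Longrightarrow> {n. P n \<subseteq> square i} = {i + j}"
    using assms unfolding numbered_pattern_def by blast
  obtain w where w: "p = range (numbering w)" using pattern_imp_numbering p(1) by blast
  obtain j' k' where Q: "\<And>i. i > k' \<Longrightarrow> {n. numbering w n \<subseteq> square i} = {i + j'}"
    using numbering_eventually by metis
  have bij_w: "bij_betw (numbering w) UNIV p" using inj_numbering w by (simp add: bij_betw_def)
  define \<tau> where "\<tau> = inv_into UNIV (numbering w) \<circ> P"
  have bij: "bij \<tau>" unfolding \<tau>_def using bij_betw_trans[OF p(2) bij_betw_inv_into[OF bij_w]] .
  have P_\<tau>: "P n = numbering w (\<tau> n)" for n
  proof -
    have "P n \<in> range (numbering w)" using p(2) w by (auto simp: bij_betw_def)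
    from f_inv_into_f[OF this] show ?thesis by (simp add: \<tau>_def)
  qed
  define K where "K = k + k'"
  have shift: "\<tau> (i + j) = i + j'" if "i > K" for i
  proof -
    have "i + j \<in> {n. P n \<subseteq> square i}" using P[of i] that by (simp add: K_def)
    then have "\<tau> (i + j) \<in> {n. numbering w n \<subseteq> square i}" by (simp add: P_\<tau>)
    moreover have "{n. numbering w n \<subseteq> square i} = {i + j'}" using that by (intro Q) (simp add: K_def)
    ultimately show ?thesis by (simp only: singleton_iff)
  qed
  have "\<tau> ` {K + j<..} = {K + j'<..}"
  proof (intro subset_antisym subsetI)
    fix m assume "m \<in> \<tau> ` {K + j<..}"
    then obtain n where "m = \<tau> n" "n > K + j" by auto
    then show "m \<in> {K + j'<..}" using shift[of "n - j"] by simp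
  next
    fix m assume "m \<in> {K + j'<..}"
    then have "m = \<tau> (m - j' + j)" "m - j' + j > K + j" using shift[of "m - j'"] by auto
    then show "m \<in> \<tau> ` {K + j<..}" by blast
  qed
  then have "\<tau> ` {..K + j} = {..K + j'}" using bij_image_Compl_eq[OF bij, of "{K + j<..}"] by simp
  \<comment> \<open>A bijection of the natural numbers cannot be a nontrivial shift far out: compare the numbers of
    elements before the shift sets in.\<close>
  then have "card (\<tau> ` {..K + j}) = card {..K + j'}" by simp
  moreover have "card (\<tau> ` {..K + j}) = card {..K + j}"
    using bij by (intro card_image) (auto simp: bij_def inj_def inj_on_def)
  ultimately have "j = j'" by simp
  have "\<tau> n = n" if "n \<ge> K + j + 1" for n
    using shift[of "n - j"] that \<open>j = j'\<close> by simp
  from ex_swap_word_permutation[OF bij this] obtain u where u: "\<And>k c. acts u (k, c) = (\<tau> k, c)"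
    by blast
  have "P = numbering (w @ u)" by (simp add: fun_eq_iff u P_\<tau>)
  then show ?thesis by blast
qed

section \<open>The presentation\<close>

lemma carrier_two_V_hat:
  "carrier two_V_hat = {f. (\<exists>f'. homeomorphism Y Y f f') \<and>
     (\<exists>P Q. numbered_pattern P \<and> numbered_pattern Q \<and> f = pair_map P Q)}"
  by (simp add: two_V_hat_def)

text \<open>This makes the set of all \<open>pair_map P Q\<close> the image of a homomorphism, hence a subgroup.\<close>

lemma two_V_hat_fractions:
  "carrier two_V_hat =
     {word_map p \<otimes>\<^bsub>BijGroup Y\<^esub> inv\<^bsub>BijGroup Y\<^esub> word_map q | p q. True}"
proof (intro subset_antisym subsetI)
  fix f assume "f \<in> carrier two_V_hat"
  then obtain P Q where "numbered_pattern P" "numbered_pattern Q" "f = pair_map P Q"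
    by (auto simp: carrier_two_V_hat)
  moreover obtain p q where "P = numbering p" "Q = numbering q"
    using numbered_pattern_imp_numbering calculation by blast
  ultimately have "f = word_map p \<otimes>\<^bsub>BijGroup Y\<^esub> inv\<^bsub>BijGroup Y\<^esub> word_map q"
    by (simp add: fraction_eq_pair_map(1))
  then show "f \<in> {word_map p \<otimes>\<^bsub>BijGroup Y\<^esub> inv\<^bsub>BijGroup Y\<^esub> word_map q | p q. True}" by blast
next
  fix f assume "f \<in> {word_map p \<otimes>\<^bsub>BijGroup Y\<^esub> inv\<^bsub>BijGroup Y\<^esub> word_map q | p q. True}"
  then obtain p q where "f = word_map p \<otimes>\<^bsub>BijGroup Y\<^esub> inv\<^bsub>BijGroup Y\<^esub> word_map q" by blast
  then have "homeomorphism Y Y f (inv_into Y f)" "f = pair_map (numbering p) (numbering q)"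
    using fraction_eq_pair_map[of p q] by simp_all
  moreover have "numbered_pattern (numbering p)" "numbered_pattern (numbering q)"
    by (rule numbered_pattern_numbering)+
  ultimately show "f \<in> carrier two_V_hat"
    unfolding carrier_two_V_hat mem_Collect_eq by (intro conjI exI)
qed

theorem theorem2:
  shows "is_presented_by two_V_hat generator_element
    (map_prod positive_word positive_word ` relations)"
proof -
  let ?B = "BijGroup Y" and ?H = "carrier two_V_hat"
  interpret B: group ?B by (rule group_BijGroup)
  have B: "word_map w \<in> carrier ?B" for w
    using B.eval_word_closed[OF generators_in_BijGroup] .
  have relation: "word_map l = word_map r" if "(l, r) \<in> relations" for l r
    using word_map_eq_iff relation_head[OF that, of "[]"] by simp
  have H: "?H = eval_word ?B generator_element ` carrier free_group"
  proof (intro subset_antisym subsetI)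
    fix f assume "f \<in> ?H"
    then obtain p q where f: "f = word_map p \<otimes>\<^bsub>?B\<^esub> inv\<^bsub>?B\<^esub> word_map q"
      by (auto simp: two_V_hat_fractions)
    interpret h: group_hom free_group ?B "eval_word ?B generator_element"
      using B.eval_word_hom[OF generators_in_BijGroup] B.group_axioms group_free_group
      by (simp add: group_hom_def group_hom_axioms_def)
    have pos: "positive_word w \<in> carrier free_group" for w :: "generator list" by (simp add: free_group_def)
    show "f \<in> eval_word ?B generator_element ` carrier free_group"
      by (rule image_eqI[of _ _ "positive_word p \<otimes>\<^bsub>free_group\<^esub> inv\<^bsub>free_group\<^esub> positive_word q"])
        (use f pos in simp_all)
  next
    fix f assume "f \<in> eval_word ?B generator_element ` carrier free_group"
    then show "f \<in> ?H"
      using B.eval_word_fraction[OF generators_in_BijGroup relation] by (auto simp: two_V_hat_fractions)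
  qed
  have subgroup: "subgroup ?H ?B"
    unfolding H using B.eval_word_hom[OF generators_in_BijGroup] B.group_axioms group_free_group
    by (intro group_hom.img_is_subgroup) (simp add: group_hom_def group_hom_axioms_def)
  have two_V: "two_V_hat = ?B\<lparr>carrier := ?H\<rparr>" by (simp add: two_V_hat_def)
  have group: "group two_V_hat"
    by (subst two_V) (rule subgroup.subgroup_is_group[OF subgroup B.group_axioms])
  have word_map: "eval_list two_V_hat generator_element w = word_map w" for w
    by (subst two_V, induction w) simp_all
  have gens: "range generator_element \<subseteq> ?H"
  proof
    fix f assume "f \<in> range generator_element"
    then obtain s where s: "f = generator_element s" by blast
    then have "f \<in> carrier ?B" using generators_in_BijGroup by blast
    then have "f = word_map [s] \<otimes>\<^bsub>?B\<^esub> inv\<^bsub>?B\<^esub> word_map []" by (simp add: s)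
    then show "f \<in> ?H" unfolding two_V_hat_fractions by blast
  qed
  have word_map_H: "word_map w \<in> ?H" for w
    using group.eval_word_closed[OF group gens, of "positive_word w"] word_map by simp
  show ?thesis
  proof (rule presented_by_relationsI[OF group gens])
    show "eval_list two_V_hat generator_element p = eval_list two_V_hat generator_element q \<longleftrightarrow> p \<doteq> q" for p q
      by (simp add: word_map word_map_eq_iff)
    fix f assume "f \<in> ?H"
    then obtain p q where "f = word_map p \<otimes>\<^bsub>?B\<^esub> inv\<^bsub>?B\<^esub> word_map q"
      by (auto simp: two_V_hat_fractions)
    moreover have "inv\<^bsub>two_V_hat\<^esub> word_map q = inv\<^bsub>?B\<^esub> word_map q"
      by (subst two_V) (rule B.m_inv_consistent[OF subgroup word_map_H])
    moreover have "mult two_V_hat = mult ?B" by (subst two_V) simp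
    ultimately show "\<exists>p q. f = eval_list two_V_hat generator_element p \<otimes>\<^bsub>two_V_hat\<^esub>
        inv\<^bsub>two_V_hat\<^esub> eval_list two_V_hat generator_element q"
      unfolding word_map by metis
  qed
qed

end
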